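(* Let $d,m$ be positive integers with $m\geqslant2$, let $1<p\leqslant2$, let $0<\varepsilon\leqslant1$, let $k\geqslant d$ be an integer, and set \[ C=C(d,m,p,\varepsilon,k)\coloneqq\exp\Big(\frac{24d\ln m}{\varepsilon^{4d}(p-1)^d}\,k^d\Big). \] Let $n\geqslant C$ be an integer, let $\mathcal{X}$ be a set with $|\mathcal{X}|=m$, and let $\boldsymbol{X}=\langle X_s:s\in\binom{[n]}{d}\rangle$ be an $\mathcal{X}$-valued, $(1/C)$-spreadable, $d$-dimensional random array on $[n]$. Assume there exists $\mathcal{S}\subseteq\mathcal{X}$ with $|\mathcal{S}|=|\mathcal{X}|-1$ such that for every $a\in\mathcal{S}$, \[ \Big|\mathbb{P}\Big(\bigcap_{s\in\mathrm{Box}(d)}[X_s=a]\Big)-\prod_{s\in\mathrm{Box}(d)}\mathbb{P}([X_s=a])\Big|\leqslant\frac1C. \] Then for every $f\colon\mathcal{X}^{\binom{[n]}{d}}\to\mathbb{R}$ with $\mathbb{E}[f(\boldsymbol{X})]=0$ and $\|f(\boldsymbol{X})\|_{L_p}=1$ there exists an interval $I$ of $[n]$ with $|I|=k$ such that for every $J\subseteq I$ with $|J|\geqslant d$, \[ \mathbb{P}\big(\big|\mathbb{E}[f(\boldsymbol{X})\,|\,\mathcal{F}_J]\big|\leqslant\varepsilon\big)\geqslant1-\varepsilon. \]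
   Context: $[n]=\{1,\dots,n\}$, $\binom{I}{d}$ is the set of $d$-element subsets of $I$. For $J\subseteq[n]$ with $|J|\geqslant d$, $\boldsymbol{X}_J=\langle X_s:s\in\binom{J}{d}\rangle$ and $\mathcal{F}_J=\sigma(\{X_s:s\in\binom{J}{d}\})$. $\boldsymbol{X}$ is $\eta$-spreadable if for all $J,K\subseteq[n]$ with $|J|=|K|\geqslant d$ the laws of $\boldsymbol{X}_J,\boldsymbol{X}_K$ (identified via the increasing bijection $J\to K$) are at total variation distance at most $\eta$. $\mathrm{Box}(d)=\{s\in\binom{[n]}{d}:|s\cap\{2i-1,2i\}|=1\text{ for all }i\in[d]\}$. An interval of $[n]$ is a set of consecutive integers. *)

theory Defs
  imports "HOL-Probability.Probability"
begin

definition dsubsets :: "nat set \<Rightarrow> nat \<Rightarrow> nat set set" where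
  "dsubsets I d = {s. s \<subseteq> I \<and> card s = d}"

definition Box :: "nat \<Rightarrow> nat \<Rightarrow> nat set set" where
  "Box n d = {s \<in> dsubsets {1..n} d. \<forall>i\<in>{1..d}. card (s \<inter> {2*i-1, 2*i}) = 1}"

definition tv_dist :: "'b measure \<Rightarrow> 'b measure \<Rightarrow> real" where
  "tv_dist P Q = (SUP A\<in>sets P. \<bar>measure P A - measure Q A\<bar>)"

text \<open>Law of the subarray indexed by the d-subsets of J, transported along a map phi
  (phi = id gives the law of X_J; phi the increasing bijection J -> K gives the law of X_K
  re-indexed by J).\<close>
definition sub_law :: "'a measure \<Rightarrow> (nat set \<Rightarrow> 'a \<Rightarrow> 'x) \<Rightarrow> nat \<Rightarrow> nat set \<Rightarrow> (nat \<Rightarrow> nat)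
    \<Rightarrow> (nat set \<Rightarrow> 'x) measure" where
  "sub_law M X d J \<phi> = distr M (PiM (dsubsets J d) (\<lambda>_. count_space UNIV))
      (\<lambda>\<omega>. \<lambda>s\<in>dsubsets J d. X (\<phi> ` s) \<omega>)"

definition spreadable :: "'a measure \<Rightarrow> (nat set \<Rightarrow> 'a \<Rightarrow> 'x) \<Rightarrow> nat \<Rightarrow> nat \<Rightarrow> real \<Rightarrow> bool" where
  "spreadable M X n d \<eta> \<longleftrightarrow>
     (\<forall>J K \<phi>. J \<subseteq> {1..n} \<and> K \<subseteq> {1..n} \<and> card J = card K \<and> card J \<ge> d \<and>
        bij_betw \<phi> J K \<and> strict_mono_on J \<phi> \<longrightarrow>
        tv_dist (sub_law M X d J id) (sub_law M X d J \<phi>) \<le> \<eta>)"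

definition gen_alg :: "'a measure \<Rightarrow> (nat set \<Rightarrow> 'a \<Rightarrow> 'x) \<Rightarrow> nat \<Rightarrow> nat set \<Rightarrow> 'a measure" where
  "gen_alg M X d J = sigma (space M) (\<Union>s\<in>dsubsets J d. {X s -` A \<inter> space M | A. A \<in> sets (count_space UNIV)})"

end

theory Submission
  imports Defs
begin

text \<open>
  For a box-independent spreadable array the entries are approximately independent and identically
  distributed. Averaging over a blow-up of the vertices turns the hypothesis on \<open>Box(d)\<close> into an
  upper bound for the box average of the indicator of \<open>X = a\<close>; a Clarkson inequality for box averages
  then shows that the centred indicator has small box average, and the Gowers--Cauchy--Schwarz inequality
  that it is nearly uncorrelated with every event depending on the other entries. Hence the subarrays on
  two disjoint intervals are nearly independent.

  If the conclusion failed for each of the \<open>N\<close> consecutive intervals of length \<open>k\<close>, each of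
  them would carry a function \<open>h\<close> of its subarray with \<open>|h| \<le> 1\<close> and
  \<open>E[f(X) h] > \<epsilon>\<^sup>2\<close>. After centring, the sum of these functions is nearly orthogonal, so its second
  moment is of order \<open>N\<close> up to a negligible error, whereas it correlates with \<open>f(X)\<close> by more
  than \<open>N \<epsilon>\<^sup>2\<close>. Truncating \<open>f(X)\<close>, which is bounded in \<open>L\<^sub>p\<close> only, at height
  \<open>(4 / \<epsilon>\<^sup>2) powr (1 / (p - 1))\<close> makes this a contradiction.
\<close>

section \<open>A Clarkson inequality for box averages\<close>

text \<open>The hypothesis controls all corners of the box at once, whereas expanding a product of
  centred indicators over the corners would need the joint law of every set of corners. Clarkson's
  inequality avoids the expansion and loses only a constant factor, so the bound stays linear in the
  errors. The blow-up is there because Cauchy--Schwarz needs an average while the hypotheses concern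
  fixed index sets: by spreadability, every choice of one point per block reproduces the same
  probabilities up to \<eta>, and coinciding pairs cost \<open>d / R\<close>.

  The only root of an error term is the \<open>2 ^ d\<close>-th one in Gowers--Cauchy--Schwarz, and
  the exponent of \<open>C\<close> pays for it. With
  \<open>L = 1 / (\<epsilon> ^ 4 * (p - 1))\<close>, \<open>C\<close> is \<open>m\<close> to the
  power \<open>24 * d * (k * L) ^ d\<close>. Two intervals carry \<open>2 * (k choose d)\<close>
  entries, so an error \<open>x\<close> for one entry grows to order
  \<open>x * m ^ (2 * (k choose d))\<close>, which must stay below
  \<open>m powr (- (2 * L))\<close>, a lower bound for what the truncation tolerates. The
  \<open>2 ^ d\<close>-th power of this requirement fits into \<open>C\<close> because
  \<open>2 ^ d * (k choose d) \<le> 2 * k ^ d\<close>.\<close>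

fun avg :: "'b set list \<Rightarrow> ('b list \<Rightarrow> real) \<Rightarrow> real" where
  "avg [] g = g []"
| "avg (A # As) g = (\<Sum>x\<in>A. avg As (\<lambda>xs. g (x # xs))) / real (card A)"

text \<open>The \<open>2 ^ length As\<close>-th power of the Gowers box norm: the average, over one
  pair of points per coordinate, of the product of \<open>g\<close> over all corners. In dimension
  zero it is \<open>g []\<close>, which may be negative; hence \<open>As \<noteq> []\<close> in the
  results on positivity.\<close>

fun boxavg :: "'b set list \<Rightarrow> ('b list \<Rightarrow> real) \<Rightarrow> real" where
  "boxavg [] g = g []"
| "boxavg (A # As) g =
     (\<Sum>x\<in>A. \<Sum>y\<in>A. boxavg As (\<lambda>xs. g (x # xs) * g (y # xs))) / (real (card A))\<^sup>2"

lemma avg_add: "avg As (\<lambda>xs. f xs + g xs) = avg As f + avg As g"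
  by (induction As arbitrary: f g) (simp_all add: sum.distrib add_divide_distrib)

lemma avg_cmult: "avg As (\<lambda>xs. c * f xs) = c * avg As f"
  by (induction As arbitrary: f) (simp_all flip: sum_distrib_left)

lemma avg_sum:
  "avg As (\<lambda>xs. \<Sum>i\<in>I. f i xs) = (\<Sum>i\<in>I. avg As (f i))"
proof (induction As arbitrary: f)
  case (Cons A As)
  show ?case
    using sum.swap[of "\<lambda>x i. avg As (\<lambda>xs. f i (x # xs))" I A]
    by (simp add: Cons.IH flip: sum_divide_distrib)
qed simp

lemma avg_mono:
  assumes "\<And>xs. xs \<in> listset As \<Longrightarrow> f xs \<le> g xs"
  shows "avg As f \<le> avg As g"
  using assms
proof (induction As arbitrary: f g)
  case (Cons A As)
  have "avg As (\<lambda>xs. f (x # xs)) \<le> avg As (\<lambda>xs. g (x # xs))" if "x \<in> A" for x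
    by (rule Cons.IH) (use that Cons.prems in \<open>auto simp: set_Cons_def\<close>)
  then show ?case
    by (auto intro!: divide_right_mono sum_mono)
qed simp

lemma avg_cong:
  assumes "\<And>xs. xs \<in> listset As \<Longrightarrow> f xs = g xs"
  shows "avg As f = avg As g"
  using avg_mono[of As f g] avg_mono[of As g f] assms by force

lemma avg_const:
  assumes "\<forall>A\<in>set As. finite A \<and> A \<noteq> {}"
  shows "avg As (\<lambda>_. c) = c"
  using assms by (induction As) auto

lemma mean_power2_le:
  fixes u :: "'i \<Rightarrow> real"
  assumes "finite I"
  shows "((\<Sum>i\<in>I. u i) / real (card I))\<^sup>2 \<le> (\<Sum>i\<in>I. (u i)\<^sup>2) / real (card I)"
proof (cases "I = {}")
  case False
  then have c: "real (card I) > 0" using assms by (simp add: card_gt_0_iff)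
  have "(\<Sum>i\<in>I. u i)\<^sup>2 \<le> (\<Sum>i\<in>I. (u i)\<^sup>2) * real (card I)"
    using sum_squared_le_sum_of_squares[of u I] by (simp add: mult.commute)
  then have "(\<Sum>i\<in>I. u i)\<^sup>2 / (real (card I))\<^sup>2 \<le> (\<Sum>i\<in>I. (u i)\<^sup>2) * real (card I) / (real (card I))\<^sup>2"
    by (rule divide_right_mono) simp
  with c show ?thesis
    by (simp add: power_divide power2_eq_square[of "real (card I)"])
qed simp

text \<open>Jensen's inequality by repeated squaring; only exponents \<open>2 ^ j\<close>
  occur.\<close>

lemma mean_power_2pow_le:
  fixes u :: "'i \<Rightarrow> real"
  assumes "finite I"
  shows "((\<Sum>i\<in>I. u i) / real (card I)) ^ (2 ^ j) \<le> (\<Sum>i\<in>I. (u i) ^ (2 ^ j)) / real (card I)"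
proof (induction j arbitrary: u)
  case (Suc j)
  have "((\<Sum>i\<in>I. u i) / real (card I)) ^ (2 ^ Suc j) = (((\<Sum>i\<in>I. u i) / real (card I))\<^sup>2) ^ (2 ^ j)"
    by (simp flip: power_mult)
  also have "\<dots> \<le> ((\<Sum>i\<in>I. (u i)\<^sup>2) / real (card I)) ^ (2 ^ j)"
    by (rule power_mono[OF mean_power2_le[OF assms]]) simp
  also have "\<dots> \<le> (\<Sum>i\<in>I. ((u i)\<^sup>2) ^ (2 ^ j)) / real (card I)"
    by (rule Suc.IH)
  finally show ?case by (simp flip: power_mult)
qed simp

lemma avg_power2_le:
  assumes "\<forall>A\<in>set As. finite A"
  shows "(avg As u)\<^sup>2 \<le> avg As (\<lambda>xs. (u xs)\<^sup>2)"
  using assms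
proof (induction As arbitrary: u)
  case (Cons A As)
  have "(avg (A # As) u)\<^sup>2 \<le> (\<Sum>x\<in>A. (avg As (\<lambda>xs. u (x # xs)))\<^sup>2) / real (card A)"
    using mean_power2_le[of A] Cons.prems by simp
  also have "\<dots> \<le> avg (A # As) (\<lambda>xs. (u xs)\<^sup>2)"
    using Cons by (auto intro!: divide_right_mono sum_mono)
  finally show ?case .
qed simp

lemma sum_swap_pairs:
  "(\<Sum>i\<in>I. \<Sum>j\<in>I. \<Sum>x\<in>A. \<Sum>y\<in>A. G i j x y) =
   (\<Sum>x\<in>A. \<Sum>y\<in>A. \<Sum>i\<in>I. \<Sum>j\<in>I. G i j x y)"
proof -
  have "(\<Sum>i\<in>I. \<Sum>j\<in>I. \<Sum>x\<in>A. \<Sum>y\<in>A. G i j x y) =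
    (\<Sum>(i, j)\<in>I \<times> I. \<Sum>(x, y)\<in>A \<times> A. G i j x y)"
    by (simp add: sum.cartesian_product[symmetric])
  also have "\<dots> = (\<Sum>(x, y)\<in>A \<times> A. \<Sum>(i, j)\<in>I \<times> I. G i j x y)"
    unfolding split_def by (rule sum.swap)
  finally show ?thesis
    by (simp add: sum.cartesian_product[symmetric])
qed

text \<open>Regrouping the four factors by \<open>i\<close> and \<open>j\<close> produces sums of
  the same shape one dimension lower, for the families \<open>f i (x # xs) * f i (y # xs)\<close>
  and likewise for \<open>g\<close>. The next two inductions rest on this.\<close>

lemma sum_boxavg_swap:
  "(\<Sum>i\<in>I. \<Sum>j\<in>I. boxavg (A # As) (\<lambda>xs. f i xs * g j xs)) =
   (\<Sum>x\<in>A. \<Sum>y\<in>A. \<Sum>i\<in>I. \<Sum>j\<in>I.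
      boxavg As (\<lambda>xs. (f i (x # xs) * f i (y # xs)) * (g j (x # xs) * g j (y # xs)))) / (real (card A))\<^sup>2"
  unfolding boxavg.simps sum_divide_distrib[symmetric]
  by (subst sum_swap_pairs) (simp only: mult_ac)

text \<open>The family index makes the induction work: in dimension zero the double sum is a square,
  and \<open>boxavg (A # As) g\<close> is itself such a double sum with
  \<open>I = A\<close>.\<close>

lemma sum_boxavg_nonneg: "0 \<le> (\<Sum>i\<in>I. \<Sum>j\<in>I. boxavg As (\<lambda>xs. f i xs * f j xs))"
proof (induction As arbitrary: f)
  case Nil
  have "(\<Sum>i\<in>I. \<Sum>j\<in>I. f i [] * f j []) = (\<Sum>i\<in>I. f i [])\<^sup>2"
    by (simp add: power2_eq_square sum_product)
  then show ?case by simp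
next
  case (Cons A As)
  show ?case unfolding sum_boxavg_swap
    by (intro divide_nonneg_nonneg sum_nonneg Cons.IH) auto
qed

lemma boxavg_nonneg:
  assumes "As \<noteq> []"
  shows "0 \<le> boxavg As g"
proof -
  obtain A Bs where As: "As = A # Bs" using assms by (cases As) auto
  show ?thesis unfolding As using sum_boxavg_nonneg[where As = Bs and I = A and f = "\<lambda>x xs. g (x # xs)"] by simp
qed

text \<open>Cauchy--Schwarz in additive form. In dimension zero the sums factor and the claim is
  \<open>a * b \<le> (a * a + b * b) / 2\<close>; regrouping carries it to higher dimension.\<close>

lemma sum_boxavg_mixed_le:
  "(\<Sum>i\<in>I. \<Sum>j\<in>I. boxavg As (\<lambda>xs. f i xs * g j xs)) \<le>
    ((\<Sum>i\<in>I. \<Sum>j\<in>I. boxavg As (\<lambda>xs. f i xs * f j xs)) +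
     (\<Sum>i\<in>I. \<Sum>j\<in>I. boxavg As (\<lambda>xs. g i xs * g j xs))) / 2"
proof (induction As arbitrary: f g)
  case Nil
  define a b where "a = (\<Sum>i\<in>I. f i [])" and "b = (\<Sum>i\<in>I. g i [])"
  have "a * b \<le> (a * a + b * b) / 2"
    using sum_squares_bound[of a b] by (simp add: power2_eq_square)
  then show ?case
    by (simp add: sum_product a_def b_def)
next
  case (Cons A As)
  let ?F = "\<lambda>f x y i xs. f i (x # xs) * f i (y # xs)"
  have "(\<Sum>x\<in>A. \<Sum>y\<in>A. \<Sum>i\<in>I. \<Sum>j\<in>I. boxavg As (\<lambda>xs. ?F f x y i xs * ?F g x y j xs)) \<le>
      (\<Sum>x\<in>A. \<Sum>y\<in>A. ((\<Sum>i\<in>I. \<Sum>j\<in>I. boxavg As (\<lambda>xs. ?F f x y i xs * ?F f x y j xs)) +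
        (\<Sum>i\<in>I. \<Sum>j\<in>I. boxavg As (\<lambda>xs. ?F g x y i xs * ?F g x y j xs))) / 2)"
    by (intro sum_mono Cons.IH)
  also have "\<dots> = ((\<Sum>x\<in>A. \<Sum>y\<in>A. \<Sum>i\<in>I. \<Sum>j\<in>I. boxavg As (\<lambda>xs. ?F f x y i xs * ?F f x y j xs)) +
      (\<Sum>x\<in>A. \<Sum>y\<in>A. \<Sum>i\<in>I. \<Sum>j\<in>I. boxavg As (\<lambda>xs. ?F g x y i xs * ?F g x y j xs))) / 2"
    by (simp only: sum_divide_distrib[symmetric] sum.distrib)
  finally have "(\<Sum>x\<in>A. \<Sum>y\<in>A. \<Sum>i\<in>I. \<Sum>j\<in>I. boxavg As (\<lambda>xs. ?F f x y i xs * ?F g x y j xs)) / (real (card A))\<^sup>2 \<le>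
    \<dots> / (real (card A))\<^sup>2" by (rule divide_right_mono) simp
  moreover have "(a + b) / 2 / c = (a / c + b / c) / 2" for a b c :: real
    by (simp add: add_divide_distrib)
  ultimately show ?case
    unfolding sum_boxavg_swap by (simp only:)
qed

text \<open>Induction on the dimension: with \<open>P = f\<^sub>x f\<^sub>y + g\<^sub>x g\<^sub>y\<close> and \<open>Q = f\<^sub>x g\<^sub>y + g\<^sub>x f\<^sub>y\<close>
  the products \<open>(f \<plusminus> g)\<^sub>x (f \<plusminus> g)\<^sub>y\<close> are \<open>P \<plusminus> Q\<close>, so one dimension lower the
  inequality applies to \<open>P, Q\<close> and once more to their summands; the mixed terms are absorbed by
  Cauchy--Schwarz.\<close>
lemma boxavg_clarkson:
  assumes "As \<noteq> []"
  shows "2 * (boxavg As (\<lambda>xs. f xs + g xs) + boxavg As (\<lambda>xs. f xs - g xs))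
    \<le> 2 ^ 2 ^ length As * (boxavg As f + boxavg As g)"
  using assms
proof (induction As arbitrary: f g)
  case (Cons A As)
  show ?case
  proof (cases "As = []")
    \<comment> \<open>In dimension one the box average is a squared mean, and the claim is the
      parallelogram identity.\<close>
    case True
    have *: "boxavg [A] h = (\<Sum>x\<in>A. h [x])\<^sup>2 / (real (card A))\<^sup>2" for h
      by (simp add: power2_eq_square sum_product)
    have "2 * ((u + v)\<^sup>2 / c + (u - v)\<^sup>2 / c) = 4 * (u\<^sup>2 / c + v\<^sup>2 / c)" for u v c :: real
      by (simp add: power2_eq_square algebra_simps add_divide_distrib diff_divide_distrib)
    then show ?thesis
      unfolding True * sum.distrib sum_subtractf by simp
  next
    case False
    \<comment> \<open>The constant one dimension lower. It is used twice, so it gets squared, which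
      is the origin of the double exponential.\<close>
    define K where "K = (2::real) ^ 2 ^ length As"
    have K: "K \<ge> 0" by (simp add: K_def)
    define B where "B f g = (\<Sum>x\<in>A. \<Sum>y\<in>A. boxavg As (\<lambda>xs. f (x # xs) * g (y # xs)))" for f g
    define c where "c = (real (card A))\<^sup>2"
    have B: "boxavg (A # As) f = B f f / c" for f
      by (simp add: B_def c_def)
    have mixed: "B f g \<le> (B f f + B g g) / 2" for f g
      unfolding B_def
      by (rule sum_boxavg_mixed_le[where As = As and I = A and f = "\<lambda>x xs. f (x # xs)" and g = "\<lambda>x xs. g (x # xs)"])
    have weak: "2 * boxavg As (\<lambda>xs. u xs + v xs) \<le> K * (boxavg As u + boxavg As v)" for u v
      using Cons.IH[OF False, of u v] boxavg_nonneg[OF False, of "\<lambda>xs. u xs - v xs"] by (simp add: K_def)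
    have pt: "4 * (boxavg As (\<lambda>xs. (f (x # xs) + g (x # xs)) * (f (y # xs) + g (y # xs)))
          + boxavg As (\<lambda>xs. (f (x # xs) - g (x # xs)) * (f (y # xs) - g (y # xs))))
        \<le> K\<^sup>2 * (boxavg As (\<lambda>xs. f (x # xs) * f (y # xs)) + boxavg As (\<lambda>xs. g (x # xs) * g (y # xs))
          + boxavg As (\<lambda>xs. f (x # xs) * g (y # xs)) + boxavg As (\<lambda>xs. g (x # xs) * f (y # xs)))"
      (is "4 * (?p + ?m) \<le> K\<^sup>2 * (?ff + ?gg + ?fg + ?gf)") for x y
    proof -
      let ?P = "\<lambda>xs. f (x # xs) * f (y # xs) + g (x # xs) * g (y # xs)"
      let ?Q = "\<lambda>xs. f (x # xs) * g (y # xs) + g (x # xs) * f (y # xs)"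
      have "2 * (boxavg As (\<lambda>xs. ?P xs + ?Q xs) + boxavg As (\<lambda>xs. ?P xs - ?Q xs)) \<le> K * (boxavg As ?P + boxavg As ?Q)"
        using Cons.IH[OF False, of ?P ?Q] by (simp only: K_def)
      also have "(\<lambda>xs. ?P xs + ?Q xs) = (\<lambda>xs. (f (x # xs) + g (x # xs)) * (f (y # xs) + g (y # xs)))"
        by (auto simp: algebra_simps)
      also have "(\<lambda>xs. ?P xs - ?Q xs) = (\<lambda>xs. (f (x # xs) - g (x # xs)) * (f (y # xs) - g (y # xs)))"
        by (auto simp: algebra_simps)
      finally have "4 * (?p + ?m) \<le> K * (2 * boxavg As ?P + 2 * boxavg As ?Q)"
        by (simp add: algebra_simps)
      also have "\<dots> \<le> K * (K * (?ff + ?gg) + K * (?fg + ?gf))"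
        by (intro mult_left_mono add_mono weak K)
      finally show ?thesis by (simp add: algebra_simps power2_eq_square)
    qed
    have "4 * (B (\<lambda>xs. f xs + g xs) (\<lambda>xs. f xs + g xs) + B (\<lambda>xs. f xs - g xs) (\<lambda>xs. f xs - g xs))
       \<le> K\<^sup>2 * (B f f + B g g + B f g + B g f)"
      unfolding B_def sum.distrib[symmetric] sum_distrib_left by (intro sum_mono pt)
    also have "\<dots> \<le> K\<^sup>2 * (2 * (B f f + B g g))"
      using mixed[of f g] mixed[of g f] by (intro mult_left_mono) (auto simp: field_simps)
    finally have "2 * (B (\<lambda>xs. f xs + g xs) (\<lambda>xs. f xs + g xs) + B (\<lambda>xs. f xs - g xs) (\<lambda>xs. f xs - g xs))
       \<le> K\<^sup>2 * (B f f + B g g)" by (simp add: algebra_simps)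
    then have "2 * (B (\<lambda>xs. f xs + g xs) (\<lambda>xs. f xs + g xs) + B (\<lambda>xs. f xs - g xs) (\<lambda>xs. f xs - g xs)) / c
       \<le> K\<^sup>2 * (B f f + B g g) / c"
      by (rule divide_right_mono) (simp add: c_def)
    moreover have "(2::real) ^ 2 ^ length (A # As) = K\<^sup>2"
      by (simp add: K_def flip: power_mult)
    ultimately show ?thesis
      unfolding B by (simp add: add_divide_distrib distrib_left)
  qed
qed simp

text \<open>Products of \<open>d\<close> functions bounded by \<open>1\<close>, the \<open>i\<close>-th of which does not depend on the
  \<open>i\<close>-th coordinate.\<close>
fun cylinder_prod :: "nat \<Rightarrow> ('b list \<Rightarrow> real) \<Rightarrow> bool" where
  "cylinder_prod 0 \<Phi> \<longleftrightarrow> \<Phi> [] = 1"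
| "cylinder_prod (Suc d) \<Phi> \<longleftrightarrow> (\<exists>\<phi> \<Psi>. (\<forall>ys. \<bar>\<phi> ys\<bar> \<le> 1) \<and>
     (\<forall>x. cylinder_prod d (\<lambda>ys. \<Psi> (x # ys))) \<and> (\<forall>x ys. \<Phi> (x # ys) = \<phi> ys * \<Psi> (x # ys)))"

lemma cylinder_prod_one: "cylinder_prod d (\<lambda>_. 1)"
  by (induction d) (auto intro!: exI[of _ "\<lambda>_. 1"])

lemma cylinder_prod_mult:
  assumes "cylinder_prod d \<Phi>" "cylinder_prod d \<Phi>'"
  shows "cylinder_prod d (\<lambda>xs. \<Phi> xs * \<Phi>' xs)"
  using assms
proof (induction d arbitrary: \<Phi> \<Phi>')
  case (Suc d)
  obtain \<phi> \<Psi> where 1: "\<And>ys. \<bar>\<phi> ys\<bar> \<le> 1" "\<And>x. cylinder_prod d (\<lambda>ys. \<Psi> (x # ys))"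
    "\<And>x ys. \<Phi> (x # ys) = \<phi> ys * \<Psi> (x # ys)"
    using Suc.prems(1) by auto
  obtain \<phi>' \<Psi>' where 2: "\<And>ys. \<bar>\<phi>' ys\<bar> \<le> 1" "\<And>x. cylinder_prod d (\<lambda>ys. \<Psi>' (x # ys))"
    "\<And>x ys. \<Phi>' (x # ys) = \<phi>' ys * \<Psi>' (x # ys)"
    using Suc.prems(2) by auto
  show ?case
    unfolding cylinder_prod.simps
  proof (rule exI[of _ "\<lambda>ys. \<phi> ys * \<phi>' ys"], rule exI[of _ "\<lambda>xs. \<Psi> xs * \<Psi>' xs"], intro conjI allI)
    show "\<bar>\<phi> ys * \<phi>' ys\<bar> \<le> 1" for ys
      using mult_mono[OF 1(1)[of ys] 2(1)[of ys]] by (simp add: abs_mult)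
  qed (use Suc.IH 1 2 in \<open>auto simp: mult_ac\<close>)
qed simp

lemma cylinder_prod_prod:
  assumes "finite T" "\<And>t. t \<in> T \<Longrightarrow> cylinder_prod d (\<Phi> t)"
  shows "cylinder_prod d (\<lambda>xs. \<Prod>t\<in>T. \<Phi> t xs)"
  using assms by (induction T) (auto intro: cylinder_prod_one cylinder_prod_mult)

text \<open>A function that ignores coordinate \<open>i\<close> fills slot \<open>i\<close> of the
  product; the other slots hold the constant 1.\<close>

lemma cylinder_prod_single:
  assumes "i < d" "\<And>xs. \<bar>\<Phi> xs\<bar> \<le> 1" "\<And>xs y. \<Phi> (xs[i := y]) = \<Phi> xs"
  shows "cylinder_prod d \<Phi>"
  using assms
proof (induction d arbitrary: i \<Phi>)
  case (Suc d)
  show ?case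
  proof (cases i)
    case 0
    have "\<Phi> (x # ys) = \<Phi> (undefined # ys)" for x ys
      using Suc.prems(3)[of "undefined # ys" x] 0 by simp
    then show ?thesis
      unfolding cylinder_prod.simps
      by (intro exI[of _ "\<lambda>ys. \<Phi> (undefined # ys)"] exI[of _ "\<lambda>_. 1"])
        (use Suc.prems in \<open>auto intro: cylinder_prod_one\<close>)
  next
    case i: (Suc j)
    have "cylinder_prod d (\<lambda>ys. \<Phi> (x # ys))" for x
    proof (rule Suc.IH[of j])
      show "\<Phi> (x # ys[j := y]) = \<Phi> (x # ys)" for ys y
        using Suc.prems(3)[of "x # ys" y] i by simp
    qed (use i Suc.prems in auto)
    then show ?thesis
      unfolding cylinder_prod.simps
      by (intro exI[of _ "\<lambda>_. 1"] exI[of _ \<Phi>]) auto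
  qed
qed simp

text \<open>Gowers--Cauchy--Schwarz. The factor \<open>\<phi>\<close> does not see the first
  coordinate, so Cauchy--Schwarz in the remaining ones removes it and doubles the first coordinate.
  What is left, \<open>\<Psi> (x # ys) * \<Psi> (y # ys)\<close>, is again a cylinder product, one
  dimension lower, and convexity moves the remaining power inside the average over \<open>x\<close>
  and \<open>y\<close>.\<close>

lemma avg_cylinder_prod_le:
  assumes "cylinder_prod (length As) \<Phi>" "\<forall>A\<in>set As. finite A \<and> A \<noteq> {}"
  shows "(avg As (\<lambda>xs. g xs * \<Phi> xs)) ^ 2 ^ length As \<le> boxavg As g"
  using assms
proof (induction As arbitrary: g \<Phi>)
  case (Cons A As)
  have fin: "finite A" "A \<noteq> {}" using Cons.prems by auto
  obtain \<phi> \<Psi> where \<phi>: "\<And>ys. \<bar>\<phi> ys\<bar> \<le> 1" and \<Psi>: "\<And>x. cylinder_prod (length As) (\<lambda>ys. \<Psi> (x # ys))"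
    and \<Phi>: "\<And>x ys. \<Phi> (x # ys) = \<phi> ys * \<Psi> (x # ys)"
    using Cons.prems(1) by auto
  define c where "c = real (card A)"
  define D where "D x y = avg As (\<lambda>ys. (g (x # ys) * g (y # ys)) * (\<Psi> (x # ys) * \<Psi> (y # ys)))" for x y
  let ?S = "\<lambda>ys. (\<Sum>x\<in>A. g (x # ys) * \<Psi> (x # ys))"
  have "(avg (A # As) (\<lambda>xs. g xs * \<Phi> xs)) = avg As (\<lambda>ys. 1 / c * (\<phi> ys * ?S ys))"
    unfolding avg_cmult avg.simps
    by (simp add: avg_sum[symmetric] \<Phi> c_def sum_distrib_left mult_ac)
  then have "(avg (A # As) (\<lambda>xs. g xs * \<Phi> xs))\<^sup>2 \<le> avg As (\<lambda>ys. (1 / c * (\<phi> ys * ?S ys))\<^sup>2)"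
    using avg_power2_le Cons.prems by auto
  also have "\<dots> \<le> avg As (\<lambda>ys. 1 / c\<^sup>2 * (?S ys)\<^sup>2)"
  proof (rule avg_mono)
    fix ys
    have "(\<phi> ys)\<^sup>2 * (?S ys)\<^sup>2 \<le> 1 * (?S ys)\<^sup>2"
      using \<phi>[of ys] by (intro mult_right_mono) (auto simp: abs_square_le_1)
    then show "(1 / c * (\<phi> ys * ?S ys))\<^sup>2 \<le> 1 / c\<^sup>2 * (?S ys)\<^sup>2"
      by (simp add: power_mult_distrib power_divide divide_right_mono)
  qed
  also have "\<dots> = (\<Sum>x\<in>A. \<Sum>y\<in>A. D x y) / c\<^sup>2"
    unfolding avg_cmult D_def avg_sum[symmetric] power2_eq_square[of "sum _ _"] sum_product
    by (simp add: mult_ac)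
  finally have sq: "(avg (A # As) (\<lambda>xs. g xs * \<Phi> xs))\<^sup>2 \<le> (\<Sum>x\<in>A. \<Sum>y\<in>A. D x y) / c\<^sup>2" .
  let ?e = "2 ^ length As :: nat"
  have "(avg (A # As) (\<lambda>xs. g xs * \<Phi> xs)) ^ 2 ^ length (A # As) = ((avg (A # As) (\<lambda>xs. g xs * \<Phi> xs))\<^sup>2) ^ ?e"
    by (simp flip: power_mult)
  also have "\<dots> \<le> ((\<Sum>x\<in>A. \<Sum>y\<in>A. D x y) / c\<^sup>2) ^ ?e"
    by (rule power_mono[OF sq]) simp
  also have "\<dots> = ((\<Sum>z\<in>A\<times>A. D (fst z) (snd z)) / real (card (A \<times> A))) ^ ?e"
    by (simp add: sum.cartesian_product split_def c_def power2_eq_square card_cartesian_product)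
  also have "\<dots> \<le> (\<Sum>z\<in>A\<times>A. D (fst z) (snd z) ^ ?e) / real (card (A \<times> A))"
    by (rule mean_power_2pow_le) (use fin in auto)
  also have "\<dots> = (\<Sum>x\<in>A. \<Sum>y\<in>A. D x y ^ ?e) / c\<^sup>2"
    by (simp add: sum.cartesian_product split_def c_def power2_eq_square card_cartesian_product)
  also have "\<dots> \<le> boxavg (A # As) g"
    unfolding boxavg.simps D_def c_def
    by (intro divide_right_mono sum_mono Cons.IH cylinder_prod_mult \<Psi>) (use Cons.prems in auto)
  finally show ?case .
qed simp

section \<open>Spreadable arrays\<close>

lemma finite_dsubsets: "finite I \<Longrightarrow> finite (dsubsets I d)"
  by (rule finite_subset[of _ "Pow I"]) (auto simp: dsubsets_def)

lemma card_dsubsets: "finite I \<Longrightarrow> card (dsubsets I d) = card I choose d"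
  using n_subsets[of I d] by (simp add: dsubsets_def)

lemma dsubsets_image:
  assumes "inj_on \<psi> I" "\<psi> ` I \<subseteq> I'" "s \<in> dsubsets I d"
  shows "\<psi> ` s \<in> dsubsets I' d"
  using assms by (auto simp: dsubsets_def card_image inj_on_subset)

lemma tv_dist_ge:
  assumes "prob_space P" "prob_space Q" "E \<in> sets P"
  shows "\<bar>measure P E - measure Q E\<bar> \<le> tv_dist P Q"
  unfolding tv_dist_def
proof (rule cSUP_upper[OF assms(3)], rule bdd_aboveI2)
  show "\<bar>measure P A - measure Q A\<bar> \<le> 1" for A
    using prob_space.prob_le_1[OF assms(1), of A] prob_space.prob_le_1[OF assms(2), of A]
      measure_nonneg[of P A] measure_nonneg[of Q A] by linarith
qed

locale spreadable_array = prob_space M for M :: "'a measure" +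
  fixes X :: "nat set \<Rightarrow> 'a \<Rightarrow> 'x" and \<X> :: "'x set" and n d :: nat and \<eta> :: real
  assumes d_pos: "d \<ge> 1"
    and X_meas: "\<And>s. s \<in> dsubsets {1..n} d \<Longrightarrow> X s \<in> measurable M (count_space UNIV)"
    and X_val: "\<And>s \<omega>. s \<in> dsubsets {1..n} d \<Longrightarrow> \<omega> \<in> space M \<Longrightarrow> X s \<omega> \<in> \<X>"
    and finite_X: "finite \<X>"
    and spread: "spreadable M X n d \<eta>"
begin

lemma sets_X_eq:
  assumes "s \<in> dsubsets {1..n} d"
  shows "{\<omega> \<in> space M. X s \<omega> = a} \<in> events"
proof -
  have "X s -` {a} \<inter> space M \<in> events"
    by (rule measurable_sets[OF X_meas[OF assms]]) simp
  moreover have "X s -` {a} \<inter> space M = {\<omega> \<in> space M. X s \<omega> = a}" by auto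
  ultimately show ?thesis by simp
qed

lemma sets_X_all_eq:
  assumes "finite T" "\<And>t. t \<in> T \<Longrightarrow> F t \<in> dsubsets {1..n} d"
  shows "{\<omega> \<in> space M. \<forall>t\<in>T. X (F t) \<omega> = b t} \<in> events"
  by (intro sets.sets_Collect_finite_All assms(1) sets_X_eq assms(2))

text \<open>The only form in which spreadability is used: prescribed values on \<open>T\<close> are
  compared with the same values on the image of \<open>T\<close> under an increasing map from an
  initial segment.\<close>

lemma spread_event:
  assumes r: "d \<le> r" "r \<le> n" and \<psi>: "strict_mono_on {1..r} \<psi>" "\<psi> ` {1..r} \<subseteq> {1..n}"
    and T: "T \<subseteq> dsubsets {1..r} d"
  shows "\<bar>prob {\<omega> \<in> space M. \<forall>t\<in>T. X t \<omega> = b t} - prob {\<omega> \<in> space M. \<forall>t\<in>T. X (\<psi> ` t) \<omega> = b t}\<bar> \<le> \<eta>"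
proof -
  let ?J = "{1..r}"
  let ?D = "dsubsets ?J d"
  let ?N = "PiM ?D (\<lambda>_. count_space (UNIV :: 'x set))"
  define E where "E = {y \<in> space ?N. \<forall>t\<in>T. y t = b t}"
  have inj: "inj_on \<psi> ?J" using \<psi>(1) by (rule strict_mono_on_imp_inj_on)
  have finT: "finite T" using T by (rule finite_subset) (simp add: finite_dsubsets)
  have "{y \<in> space ?N. y t = b t} \<in> sets ?N" if "t \<in> T" for t
  proof -
    have "(\<lambda>y. y t) -` {b t} \<inter> space ?N \<in> sets ?N"
      by (rule measurable_sets[OF measurable_component_singleton]) (use that T in auto)
    then show ?thesis by (simp add: vimage_def Int_def conj_commute)
  qed
  then have E: "E \<in> sets ?N"
    unfolding E_def by (intro sets.sets_Collect_finite_All finT) auto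
  have law: "sub_law M X d ?J \<phi> = distr M ?N (\<lambda>\<omega>. \<lambda>s\<in>?D. X (\<phi> ` s) \<omega>)" for \<phi>
    by (simp add: sub_law_def)
  have meas: "(\<lambda>\<omega>. \<lambda>s\<in>?D. X (\<phi> ` s) \<omega>) \<in> measurable M ?N"
    if "\<And>s. s \<in> ?D \<Longrightarrow> \<phi> ` s \<in> dsubsets {1..n} d" for \<phi>
    by (intro measurable_restrict X_meas that)
  have m\<psi>: "\<psi> ` s \<in> dsubsets {1..n} d" if "s \<in> ?D" for s
    using that dsubsets_image[OF inj \<psi>(2)] by auto
  have mid: "id ` s \<in> dsubsets {1..n} d" if "s \<in> ?D" for s
    using that r by (auto simp: dsubsets_def)
  have meq: "measure (sub_law M X d ?J \<phi>) E = prob {\<omega> \<in> space M. \<forall>t\<in>T. X (\<phi> ` t) \<omega> = b t}"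
    if "\<And>s. s \<in> ?D \<Longrightarrow> \<phi> ` s \<in> dsubsets {1..n} d" for \<phi>
  proof -
    have "(\<lambda>\<omega>. \<lambda>s\<in>?D. X (\<phi> ` s) \<omega>) -` E \<inter> space M = {\<omega> \<in> space M. \<forall>t\<in>T. X (\<phi> ` t) \<omega> = b t}"
      using T by (auto simp: E_def space_PiM subset_eq)
    then show ?thesis unfolding law using measure_distr[OF meas[OF that] E] by simp
  qed
  have ps: "prob_space (sub_law M X d ?J \<phi>)"
    if "\<And>s. s \<in> ?D \<Longrightarrow> \<phi> ` s \<in> dsubsets {1..n} d" for \<phi>
    unfolding law by (rule prob_space_distr[OF meas[OF that]])
  have "tv_dist (sub_law M X d ?J id) (sub_law M X d ?J \<psi>) \<le> \<eta>"
    by (rule spread[unfolded spreadable_def, rule_format, of ?J "\<psi> ` ?J" \<psi>])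
      (use r \<psi> inj in \<open>auto simp: card_image bij_betw_def\<close>)
  moreover have "\<bar>measure (sub_law M X d ?J id) E - measure (sub_law M X d ?J \<psi>) E\<bar> \<le>
      tv_dist (sub_law M X d ?J id) (sub_law M X d ?J \<psi>)"
    by (rule tv_dist_ge[OF ps[OF mid] ps[OF m\<psi>]]) (simp_all only: law sets_distr E)
  ultimately show ?thesis
    using meq[of id, OF mid] meq[of \<psi>, OF m\<psi>] by simp
qed

definition marg :: "'x \<Rightarrow> real" where
  "marg a = prob {\<omega> \<in> space M. X {1..d} \<omega> = a}"

lemma marg_nonneg: "0 \<le> marg a" and marg_le_1: "marg a \<le> 1"
  by (simp_all add: marg_def)

lemma sum_marg:
  assumes "d \<le> n"
  shows "(\<Sum>a\<in>\<X>. marg a) = 1"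
proof -
  have D: "{1..d} \<in> dsubsets {1..n} d" using assms by (auto simp: dsubsets_def)
  have "(\<Sum>a\<in>\<X>. marg a) = prob (\<Union>a\<in>\<X>. {\<omega> \<in> space M. X {1..d} \<omega> = a})"
    unfolding marg_def
    by (rule finite_measure_finite_Union[symmetric])
      (use finite_X sets_X_eq[OF D] in \<open>auto simp: disjoint_family_on_def\<close>)
  also have "(\<Union>a\<in>\<X>. {\<omega> \<in> space M. X {1..d} \<omega> = a}) = space M"
    using X_val[OF D] by auto
  finally show ?thesis by (simp add: prob_space)
qed

lemma prob_eq_marg:
  assumes s: "s \<in> dsubsets {1..n} d"
  shows "\<bar>prob {\<omega> \<in> space M. X s \<omega> = a} - marg a\<bar> \<le> \<eta>"
proof -
  have fs: "finite s" "card s = d" "s \<subseteq> {1..n}"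
    using s by (auto simp: dsubsets_def intro: finite_subset)
  \<comment> \<open>The increasing enumeration of \<open>s\<close>; vertices count from 1, list
    positions from 0.\<close>
  define \<psi> where "\<psi> i = sorted_list_of_set s ! (i - 1)" for i
  have len: "length (sorted_list_of_set s) = d" using fs by simp
  have img: "\<psi> ` {1..d} = s"
  proof -
    have "\<psi> ` {1..d} = (!) (sorted_list_of_set s) ` {..<d}"
      by (force simp: \<psi>_def image_iff Suc_le_eq intro: bexI[of _ "Suc _"])
    also have "\<dots> = s" using len fs nth_image[of d "sorted_list_of_set s"] by (simp add: lessThan_atLeast0)
    finally show ?thesis .
  qed
  have "strict_mono_on {1..d} \<psi>"
    unfolding \<psi>_def
    by (intro strict_mono_onI sorted_wrt_nth_less[OF strict_sorted_list_of_set]) (use len in auto)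
  moreover have "d \<le> n" using card_mono[OF _ fs(3)] fs by simp
  ultimately show ?thesis
    using spread_event[of d \<psi> "{{1..d}}" "\<lambda>_. a"] img fs by (auto simp: dsubsets_def marg_def abs_minus_commute)
qed

end

section \<open>Averages of indicators, and convexity estimates\<close>

lemma in_listset_iff: "xs \<in> listset As \<longleftrightarrow> length xs = length As \<and> (\<forall>i<length As. xs ! i \<in> As ! i)"
proof (induction As arbitrary: xs)
  case (Cons A As)
  show ?case
    by (cases xs) (auto simp: set_Cons_def Cons.IH less_Suc_eq_0_disj)
qed simp

text \<open>A product of indicators is the indicator of a conjunction, so the box average becomes a
  plain average over lists of pairs. That average is linear and commutes with the
  expectation.\<close>

lemma boxavg_of_bool:
  "boxavg As (\<lambda>xs. of_bool (P xs)) = avg (map (\<lambda>A. A \<times> A) As)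
     (\<lambda>ps. of_bool (\<forall>xs\<in>listset (map (\<lambda>(x, y). {x, y}) ps). P xs))"
proof (induction As arbitrary: P)
  case (Cons A As)
  have "boxavg (A # As) (\<lambda>xs. of_bool (P xs)) =
    (\<Sum>x\<in>A. \<Sum>y\<in>A. boxavg As (\<lambda>xs. of_bool (P (x # xs) \<and> P (y # xs)))) / (real (card A))\<^sup>2"
    by (simp only: boxavg.simps of_bool_conj)
  also have "\<dots> = (\<Sum>z\<in>A \<times> A. avg (map (\<lambda>A. A \<times> A) As)
      (\<lambda>ps. of_bool (\<forall>xs\<in>listset (map (\<lambda>(x, y). {x, y}) ps). P (fst z # xs) \<and> P (snd z # xs)))) / (real (card A))\<^sup>2"
    by (simp only: Cons.IH sum.cartesian_product split_def)
  also have "\<dots> = avg (map (\<lambda>A. A \<times> A) (A # As))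
     (\<lambda>ps. of_bool (\<forall>xs\<in>listset (map (\<lambda>(x, y). {x, y}) ps). P xs))"
  proof -
    have "(\<forall>xs\<in>L. P (fst z # xs) \<and> P (snd z # xs)) \<longleftrightarrow> (\<forall>xs\<in>set_Cons {fst z, snd z} L. P xs)" for z L
      by (auto simp: set_Cons_def)
    then show ?thesis by (simp add: card_cartesian_product power2_eq_square split_def)
  qed
  finally show ?case .
qed simp

lemma boxavg_const:
  assumes "\<forall>A\<in>set As. finite A \<and> A \<noteq> {}"
  shows "boxavg As (\<lambda>_. c) = c ^ 2 ^ length As"
  using assms
  by (induction As arbitrary: c) (auto simp: power2_eq_square power_mult_distrib mult_2 power_add)

lemma boxavg_abs_le:
  assumes "\<And>xs. \<bar>g xs\<bar> \<le> B" "\<forall>A\<in>set As. finite A \<and> A \<noteq> {}"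
  shows "\<bar>boxavg As g\<bar> \<le> B ^ 2 ^ length As"
  using assms
proof (induction As arbitrary: g B)
  case (Cons A As)
  have B: "0 \<le> B" using Cons.prems(1)[of undefined] by linarith
  have "\<bar>boxavg As (\<lambda>xs. g (x # xs) * g (y # xs))\<bar> \<le> (B * B) ^ 2 ^ length As" for x y
    by (rule Cons.IH) (use Cons.prems B in \<open>auto simp: abs_mult intro!: mult_mono\<close>)
  then have "\<bar>\<Sum>x\<in>A. \<Sum>y\<in>A. boxavg As (\<lambda>xs. g (x # xs) * g (y # xs))\<bar> \<le> (\<Sum>x\<in>A. \<Sum>y\<in>A. (B * B) ^ 2 ^ length As)"
    by (intro order_trans[OF sum_abs] sum_mono order_trans[OF sum_abs])
  then have "\<bar>boxavg (A # As) g\<bar> \<le> (\<Sum>x\<in>A. \<Sum>y\<in>A. (B * B) ^ 2 ^ length As) / (real (card A))\<^sup>2"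
    by (simp add: divide_right_mono del: sum_constant)
  also have "\<dots> = B ^ 2 ^ length (A # As)"
    using Cons.prems by (auto simp: power2_eq_square power_mult_distrib mult_2 power_add)
  finally show ?case .
qed simp

lemma boxavg_measurable:
  assumes "\<And>xs. xs \<in> listset As \<Longrightarrow> (\<lambda>\<omega>. g \<omega> xs) \<in> borel_measurable M"
  shows "(\<lambda>\<omega>. boxavg As (g \<omega>)) \<in> borel_measurable M"
  using assms
proof (induction As arbitrary: g)
  case (Cons A As)
  have "(\<lambda>\<omega>. boxavg As (\<lambda>xs. g \<omega> (x # xs) * g \<omega> (y # xs))) \<in> borel_measurable M" if "x \<in> A" "y \<in> A" for x y
    by (intro Cons.IH borel_measurable_times Cons.prems) (use that in \<open>auto simp: set_Cons_def\<close>)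
  then show ?case by simp
qed simp

lemma integral_avg:
  fixes u :: "'a \<Rightarrow> 'b list \<Rightarrow> real"
  assumes "\<And>xs. xs \<in> listset As \<Longrightarrow> integrable M (\<lambda>\<omega>. u \<omega> xs)"
  shows "integrable M (\<lambda>\<omega>. avg As (u \<omega>)) \<and>
    (\<integral>\<omega>. avg As (u \<omega>) \<partial>M) = avg As (\<lambda>xs. \<integral>\<omega>. u \<omega> xs \<partial>M)"
  using assms
proof (induction As arbitrary: u)
  case (Cons A As)
  have "integrable M (\<lambda>\<omega>. avg As (\<lambda>xs. u \<omega> (x # xs))) \<and>
    (\<integral>\<omega>. avg As (\<lambda>xs. u \<omega> (x # xs)) \<partial>M) = avg As (\<lambda>xs. \<integral>\<omega>. u \<omega> (x # xs) \<partial>M)" if "x \<in> A" for x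
    by (rule Cons.IH, rule Cons.prems) (use that in \<open>auto simp: set_Cons_def\<close>)
  then show ?case by (simp add: Bochner_Integration.integral_sum)
qed simp

text \<open>Union bound: a random pair from a set of size \<open>R\<close> coincides with
  probability \<open>1 / R\<close>, once for each coordinate.\<close>

lemma avg_pairs_le:
  assumes A: "\<forall>A\<in>set As. card A = R" and R: "R > 0"
    and u1: "\<And>ps. ps \<in> listset (map (\<lambda>A. A \<times> A) As) \<Longrightarrow> u ps \<le> 1"
    and uc: "\<And>ps. ps \<in> listset (map (\<lambda>A. A \<times> A) As) \<Longrightarrow> \<forall>p\<in>set ps. fst p \<noteq> snd p \<Longrightarrow> u ps \<le> c"
    and c: "c \<ge> 0"
  shows "avg (map (\<lambda>A. A \<times> A) As) u \<le> c + real (length As) / real R"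
  using A u1 uc
proof (induction As arbitrary: u)
  case (Cons A As)
  let ?As = "map (\<lambda>A. A \<times> A) As"
  let ?v = "c + real (length As) / real R"
  have A: "finite A" "card A = R" using Cons.prems R by (auto intro: card_ge_0_finite)
  have "\<forall>B\<in>set As. finite B \<and> B \<noteq> {}"
    using Cons.prems(1) R by (metis card.empty card.infinite less_irrefl list.set_intros(2))
  then have fin: "\<forall>B\<in>set ?As. finite B \<and> B \<noteq> {}"
    by auto
  have "avg ?As (\<lambda>ps. u (z # ps)) \<le> ?v + of_bool (fst z = snd z)" if z: "z \<in> A \<times> A" for z
  proof (cases "fst z = snd z")
    case True
    have "avg ?As (\<lambda>ps. u (z # ps)) \<le> avg ?As (\<lambda>_. 1)"
      by (rule avg_mono) (use z in \<open>auto simp: set_Cons_def intro!: Cons.prems\<close>)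
    also have "\<dots> = 1" by (rule avg_const[OF fin])
    also have "1 \<le> ?v + 1" using c by simp
    finally show ?thesis using True by simp
  next
    case False
    have "avg ?As (\<lambda>ps. u (z # ps)) \<le> ?v"
    proof (rule Cons.IH)
      fix ps assume ps: "ps \<in> listset ?As"
      with z have z': "z # ps \<in> listset (map (\<lambda>A. A \<times> A) (A # As))" by (auto simp: set_Cons_def)
      then show "u (z # ps) \<le> 1" by (rule Cons.prems(2))
      assume "\<forall>p\<in>set ps. fst p \<noteq> snd p"
      with False show "u (z # ps) \<le> c" by (intro Cons.prems(3)[OF z']) auto
    qed (use Cons.prems(1) in auto)
    then show ?thesis using False by simp
  qed
  then have "(\<Sum>z\<in>A \<times> A. avg ?As (\<lambda>ps. u (z # ps))) \<le> (\<Sum>z\<in>A \<times> A. ?v + of_bool (fst z = snd z))"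
    by (rule sum_mono)
  also have "\<dots> = real R * real R * ?v + real R"
    using A by (simp add: sum.distrib card_cartesian_product sum.cartesian_product[symmetric, of "\<lambda>x y. of_bool (x = y)", simplified split_def])
  finally have "(\<Sum>z\<in>A \<times> A. avg ?As (\<lambda>ps. u (z # ps))) / (real R * real R) \<le> (real R * real R * ?v + real R) / (real R * real R)"
    by (rule divide_right_mono) simp
  also have "\<dots> = ?v + 1 / real R"
    using R by (simp add: field_simps)
  finally show ?case
    using A by (simp add: card_cartesian_product add_divide_distrib)
qed (use c in auto)

text \<open>Convexity with a lower bound affine in \<open>t\<close>, so that a mean of
  \<open>t\<close> is all that has to be known. The induction multiplies by \<open>t\<close> and
  discards a multiple of \<open>(t - u)\<^sup>2\<close>.\<close>

lemma power_ge_tangent: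
  fixes t u :: real
  assumes "t \<ge> 0" "u \<ge> 0"
  shows "u ^ Suc m + real (Suc m) * u ^ m * (t - u) \<le> t ^ Suc m"
proof (induction m)
  case (Suc m)
  have "u ^ Suc (Suc m) + real (Suc (Suc m)) * u ^ Suc m * (t - u)
      = t * (u ^ Suc m + real (Suc m) * u ^ m * (t - u)) - real (Suc m) * u ^ m * (t - u)\<^sup>2"
    by (simp add: algebra_simps power2_eq_square)
  also have "\<dots> \<le> t * t ^ Suc m"
    using mult_left_mono[OF Suc.IH assms(1)] assms by (smt (verit) mult_nonneg_nonneg of_nat_0_le_iff zero_le_power2 zero_le_power)
  finally show ?case by simp
qed simp

text \<open>Factors are exchanged one by one; as they and \<open>p\<close> are at most 1, each
  exchange costs only \<open>\<eta>\<close>.\<close>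

lemma prod_le_power_plus:
  fixes u :: "'i \<Rightarrow> real"
  assumes "finite I" "\<And>i. i \<in> I \<Longrightarrow> 0 \<le> u i" "\<And>i. i \<in> I \<Longrightarrow> u i \<le> 1" "\<And>i. i \<in> I \<Longrightarrow> u i \<le> p + \<eta>"
    and "0 \<le> p" "p \<le> 1" "0 \<le> \<eta>"
  shows "(\<Prod>i\<in>I. u i) \<le> p ^ card I + real (card I) * \<eta>"
  using assms(1-4)
proof (induction I)
  case (insert i I)
  have P: "0 \<le> prod u I" "prod u I \<le> 1"
    using insert.prems by (auto intro!: prod_nonneg prod_le_1)
  have "u i * prod u I \<le> (p + \<eta>) * prod u I"
    using insert.prems P by (intro mult_right_mono) auto
  also have "\<dots> \<le> p * (p ^ card I + real (card I) * \<eta>) + \<eta> * 1"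
    unfolding distrib_right using insert P assms by (intro add_mono mult_left_mono) auto
  also have "\<dots> \<le> p * p ^ card I + 1 * (real (card I) * \<eta>) + \<eta>"
    unfolding distrib_left using assms by (intro add_mono mult_right_mono) auto
  finally show ?case using insert by (simp add: algebra_simps)
qed simp

lemma (in prob_space) expectation_power_2pow_le:
  fixes h :: "'a \<Rightarrow> real"
  assumes "h \<in> borel_measurable M" "\<And>\<omega>. \<omega> \<in> space M \<Longrightarrow> \<bar>h \<omega>\<bar> \<le> B"
  shows "expectation h ^ 2 ^ j \<le> expectation (\<lambda>\<omega>. h \<omega> ^ 2 ^ j)"
  using assms
proof (induction j arbitrary: h B)
  case (Suc j)
  have B: "\<bar>(h \<omega>)\<^sup>2\<bar> \<le> B\<^sup>2" if "\<omega> \<in> space M" for \<omega>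
    using power_mono[OF Suc.prems(2)[OF that], of 2] by simp
  have int: "integrable M h" "integrable M (\<lambda>\<omega>. (h \<omega>)\<^sup>2)"
    using Suc.prems B by (auto intro: integrable_const_bound[of _ B] integrable_const_bound[of _ "B\<^sup>2"])
  have "(expectation h)\<^sup>2 \<le> expectation (\<lambda>\<omega>. (h \<omega>)\<^sup>2)"
    using variance_positive[of h] variance_eq[OF int] by simp
  then have "((expectation h)\<^sup>2) ^ 2 ^ j \<le> expectation (\<lambda>\<omega>. (h \<omega>)\<^sup>2) ^ 2 ^ j"
    by (rule power_mono) simp
  also have "\<dots> \<le> expectation (\<lambda>\<omega>. ((h \<omega>)\<^sup>2) ^ 2 ^ j)"
    by (rule Suc.IH[of _ "B\<^sup>2"]) (use Suc.prems B in auto)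
  finally show ?case by (simp flip: power_mult)
qed simp

section \<open>Corners of the box and blow-ups of the vertices\<close>

lemma Box_iff:
  "t \<in> Box n d \<longleftrightarrow> t \<subseteq> {1..n} \<and> card t = d \<and> (\<forall>i<d. card (t \<inter> {2 * i + 1, 2 * i + 2}) = 1)"
proof -
  have "(\<forall>i\<in>{1..d}. card (t \<inter> {2*i-1, 2*i}) = 1) \<longleftrightarrow> (\<forall>i<d. card (t \<inter> {2 * i + 1, 2 * i + 2}) = 1)"
  proof safe
    fix i assume *: "\<forall>i\<in>{1..d}. card (t \<inter> {2*i-1, 2*i}) = 1" "i < d"
    then have "card (t \<inter> {2*(i+1)-1, 2*(i+1)}) = 1" by (intro bspec[OF *(1)]) auto
    then show "card (t \<inter> {2 * i + 1, 2 * i + 2}) = 1" by simp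
  next
    fix i assume *: "\<forall>i<d. card (t \<inter> {2 * i + 1, 2 * i + 2}) = 1" "i \<in> {1..d}"
    then have "card (t \<inter> {2*(i-1)+1, 2*(i-1)+2}) = 1" by (intro mp[OF spec[OF *(1)]]) auto
    moreover have "2*(i-1)+1 = 2*i-1" "2*(i-1)+2 = 2*i" using *(2) by auto
    ultimately show "card (t \<inter> {2*i-1, 2*i}) = 1" by simp
  qed
  then show ?thesis unfolding Box_def dsubsets_def mem_Collect_eq by (simp only: conj_assoc)
qed

text \<open>Choice of one point from each pair of the box, numbered from 0: \<open>S\<close> lists
  the pairs in which the smaller, odd point is taken.\<close>

definition pick :: "nat set \<Rightarrow> nat \<Rightarrow> nat" where
  "pick S i = (if i \<in> S then 2 * i + 1 else 2 * i + 2)"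

lemma inj_pick: "inj_on (pick S) I"
proof (rule inj_onI)
  fix i j assume "pick S i = pick S j"
  moreover have "(pick S k - 1) div 2 = k" for k by (auto simp: pick_def)
  from this[of i] this[of j] calculation show "i = j" by simp
qed

text \<open>A set in the box meets each of \<open>d\<close> disjoint pairs and has only
  \<open>d\<close> elements, so no element lies outside the pairs.\<close>

lemma Box_eq_pick:
  assumes "t \<in> Box n d"
  shows "t = pick {i. 2 * i + 1 \<in> t} ` {..<d}"
proof (rule card_subset_eq[symmetric])
  show "finite t" using assms by (auto simp: Box_iff intro: finite_subset)
  show "card (pick {i. 2 * i + 1 \<in> t} ` {..<d}) = card t"
    using assms by (simp add: card_image inj_pick Box_iff)
  show "pick {i. 2 * i + 1 \<in> t} ` {..<d} \<subseteq> t"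
  proof safe
    fix i assume "i < d"
    then have "card (t \<inter> {2 * i + 1, 2 * i + 2}) = 1" using assms by (auto simp: Box_iff)
    then have "t \<inter> {2 * i + 1, 2 * i + 2} \<noteq> {}" by (metis card.empty zero_neq_one)
    then show "pick {i. 2 * i + 1 \<in> t} i \<in> t" by (auto simp: pick_def)
  qed
qed

lemma pick_eq_odd: "pick S i = 2 * j + 1 \<longleftrightarrow> i = j \<and> j \<in> S"
  unfolding pick_def by (cases "i \<in> S"; cases "j \<in> S"; auto; presburger)

lemma pick_eq_even: "pick S i = 2 * j + 2 \<longleftrightarrow> i = j \<and> j \<notin> S"
  unfolding pick_def by (cases "i \<in> S"; cases "j \<in> S"; auto; presburger)

lemma card_Box:
  assumes "2 * d \<le> n"
  shows "card (Box n d) = 2 ^ d"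
proof -
  have "bij_betw (\<lambda>S. pick S ` {..<d}) (Pow {..<d}) (Box n d)"
  proof (rule bij_betw_byWitness[where f' = "\<lambda>t. {i. i < d \<and> 2 * i + 1 \<in> t}"])
    show "\<forall>S\<in>Pow {..<d}. {i. i < d \<and> 2 * i + 1 \<in> pick S ` {..<d}} = S"
    proof
      fix S assume "S \<in> Pow {..<d}"
      moreover have "2 * i + 1 \<in> pick S ` {..<d} \<longleftrightarrow> i < d \<and> i \<in> S" for i
        unfolding image_iff eq_commute[of "2 * i + 1"] pick_eq_odd by blast
      ultimately show "{i. i < d \<and> 2 * i + 1 \<in> pick S ` {..<d}} = S" by auto
    qed
    show "\<forall>t\<in>Box n d. pick {i. i < d \<and> 2 * i + 1 \<in> t} ` {..<d} = t"
    proof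
      fix t assume t: "t \<in> Box n d"
      have "pick {i. i < d \<and> 2 * i + 1 \<in> t} ` {..<d} = pick {i. 2 * i + 1 \<in> t} ` {..<d}"
        by (rule image_cong) (auto simp: pick_def)
      with Box_eq_pick[OF t] show "pick {i. i < d \<and> 2 * i + 1 \<in> t} ` {..<d} = t" by simp
    qed
    show "(\<lambda>S. pick S ` {..<d}) ` Pow {..<d} \<subseteq> Box n d"
    proof safe
      fix S
      have "pick S ` {..<d} \<inter> {2 * i + 1, 2 * i + 2} = {pick S i}" if "i < d" for i
      proof -
        have "pick S i \<in> {2 * i + 1, 2 * i + 2}" by (simp add: pick_def)
        moreover have "k = i" if "pick S k \<in> {2 * i + 1, 2 * i + 2}" for k
          using that pick_eq_odd[of S k i] pick_eq_even[of S k i] by auto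
        ultimately show ?thesis using that by blast
      qed
      then have "card (pick S ` {..<d} \<inter> {2 * i + 1, 2 * i + 2}) = 1" if "i < d" for i
        using that by simp
      moreover have "pick S ` {..<d} \<subseteq> {1..n}" using assms by (auto simp: pick_def)
      ultimately show "pick S ` {..<d} \<in> Box n d"
        unfolding Box_iff by (simp only: card_image[OF inj_pick] card_lessThan) simp
    qed
    show "(\<lambda>t. {i. i < d \<and> 2 * i + 1 \<in> t}) ` Box n d \<subseteq> Pow {..<d}" by auto
  qed
  then show ?thesis by (simp add: card_Pow flip: bij_betw_same_card)
qed

text \<open>Consecutive intervals of length \<open>R\<close>, numbered from 1;
  \<open>block R 0\<close> is empty by truncated subtraction.\<close>

definition block :: "nat \<Rightarrow> nat \<Rightarrow> nat set" where
  "block R v = {R * (v - 1) + 1..R * v}"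

lemma card_block: "1 \<le> v \<Longrightarrow> card (block R v) = R"
  by (cases v) (auto simp: block_def)

lemma block_less:
  assumes "u < v" "x \<in> block R u" "y \<in> block R v"
  shows "x < y"
proof -
  have "R * u \<le> R * (v - 1)" using assms(1) by (intro mult_le_mono2) auto
  then show ?thesis using assms unfolding block_def atLeastAtMost_iff by linarith
qed

lemma block_subset:
  assumes "v \<le> r" "R * r \<le> n"
  shows "block R v \<subseteq> {1..n}"
proof -
  have "R * v \<le> n" using mult_le_mono2[OF assms(1), of R] assms(2) by linarith
  then show ?thesis by (auto simp: block_def)
qed

text \<open>One point from every block is automatically an increasing choice, which is what
  \<open>spread_event\<close> asks for.\<close>

lemma block_map:
  assumes "\<And>v. v \<in> {1..r} \<Longrightarrow> \<psi> v \<in> block R v" "R * r \<le> n"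
  shows "strict_mono_on {1..r} \<psi>" "\<psi> ` {1..r} \<subseteq> {1..n}"
proof -
  show "strict_mono_on {1..r} \<psi>"
  proof (rule strict_mono_onI)
    fix u v assume "u \<in> {1..r}" "v \<in> {1..r}" "u < v"
    then show "\<psi> u < \<psi> v" by (metis block_less assms(1))
  qed
  show "\<psi> ` {1..r} \<subseteq> {1..n}"
  proof (rule image_subsetI)
    fix v assume "v \<in> {1..r}"
    then show "\<psi> v \<in> {1..n}" using assms(1)[of v] block_subset[OF _ assms(2), of v] by auto
  qed
qed

text \<open>The vertex \<open>v\<close> is blown up to \<open>block R v\<close>; vertices in \<open>vs\<close> move freely inside their blocks, all
  others stay at the right end point.\<close>
definition subst_vertices :: "nat \<Rightarrow> nat list \<Rightarrow> nat list \<Rightarrow> nat \<Rightarrow> nat" where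
  "subst_vertices R vs xs v = (case map_of (zip vs xs) v of Some x \<Rightarrow> x | None \<Rightarrow> R * v)"

lemma subst_vertices_nth:
  assumes "distinct vs" "length xs = length vs" "i < length vs"
  shows "subst_vertices R vs xs (vs ! i) = xs ! i"
  using assms by (simp add: subst_vertices_def map_of_zip_nth)

lemma subst_vertices_image:
  assumes "distinct vs" "length xs = length vs"
  shows "subst_vertices R vs xs ` set vs = set xs"
proof -
  have "subst_vertices R vs xs ` set vs = (\<lambda>i. subst_vertices R vs xs (vs ! i)) ` {..<length vs}"
    by (auto simp: set_conv_nth)
  also have "\<dots> = (!) xs ` {..<length xs}"
    using assms by (intro image_cong) (auto simp: subst_vertices_nth)
  finally show ?thesis by (auto simp: set_conv_nth)
qed

lemma subst_vertices_block:
  assumes "xs \<in> listset (map (block R) vs)" "distinct vs" "R > 0" "v \<ge> 1"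
  shows "subst_vertices R vs xs v \<in> block R v"
proof (cases "v \<in> set vs")
  case True
  then obtain i where "i < length vs" "v = vs ! i" by (auto simp: in_set_conv_nth)
  then show ?thesis using assms by (auto simp: in_listset_iff subst_vertices_nth)
next
  case False
  then have "map_of (zip vs xs) v = None"
    by (auto simp: map_of_eq_None_iff dest: set_zip_leftD)
  then show ?thesis using assms by (cases v) (auto simp: subst_vertices_def block_def)
qed

lemma subst_vertices_update:
  assumes "distinct vs" "v \<noteq> vs ! i" "i < length vs"
  shows "subst_vertices R vs (xs[i := y]) v = subst_vertices R vs xs v"
proof -
  have "map_of (zip vs (xs[i := y])) v = map_of (zip vs xs) v"
    using assms
  proof (induction vs arbitrary: xs i)
    case (Cons w vs)
    show ?case
    proof (cases xs)
      case (Cons x xs')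
      then show ?thesis using Cons.IH[of "i - 1" xs'] Cons.prems by (cases i) auto
    qed simp
  qed simp
  then show ?thesis by (simp add: subst_vertices_def)
qed

section \<open>Box independence implies approximate independence\<close>

lemma half_eq_less_parity:
  fixes i j :: nat
  assumes "i div 2 = j div 2" "i < j"
  shows "even i \<and> odd j"
  using assms by presburger

context spreadable_array
begin

lemma eta_nonneg:
  assumes "d \<le> n"
  shows "0 \<le> \<eta>"
proof -
  have "{1..d} \<in> dsubsets {1..n} d" using assms by (auto simp: dsubsets_def)
  from prob_eq_marg[OF this] show ?thesis by (meson abs_ge_zero order_trans)
qed

context
  fixes r R :: nat and s vs As
  assumes s: "s \<in> dsubsets {1..r} d" and R: "R > 0" "R * r \<le> n" and dn: "2 * d \<le> n"
    and vs: "vs = sorted_list_of_set s" and As: "As = map (block R) vs"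
begin

lemma vs_props: "finite s" "set vs = s" "distinct vs" "length vs = d" "s \<subseteq> {1..r}" "length As = d"
  "\<And>i. i < d \<Longrightarrow> vs ! i \<in> s" "\<And>i. i < d \<Longrightarrow> 1 \<le> vs ! i \<and> vs ! i \<le> r"
  "\<And>i j. i < j \<Longrightarrow> j < d \<Longrightarrow> vs ! i < vs ! j"
proof -
  show fs: "finite s" "s \<subseteq> {1..r}" using s by (auto simp: dsubsets_def intro: finite_subset)
  show vd: "set vs = s" "distinct vs" "length vs = d" using fs s by (auto simp: vs dsubsets_def)
  then show "length As = d" by (simp add: As)
  show n: "vs ! i \<in> s" if "i < d" for i using that vd nth_mem by metis
  show "1 \<le> vs ! i \<and> vs ! i \<le> r" if "i < d" for i using n[OF that] fs by auto
  show "vs ! i < vs ! j" if "i < j" "j < d" for i j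
    using sorted_wrt_nth_less[OF strict_sorted_list_of_set[of s]] that vd by (simp add: vs)
qed

lemma As_card: "\<forall>A\<in>set As. card A = R"
  using vs_props(2,5) by (auto simp: As intro!: card_block)

lemma As_finite: "\<forall>A\<in>set As. finite A \<and> A \<noteq> {}"
  using As_card R by (metis card.empty card.infinite less_irrefl)

lemma subst_map:
  assumes "xs \<in> listset As"
  shows "strict_mono_on {1..r} (subst_vertices R vs xs)" "subst_vertices R vs xs ` {1..r} \<subseteq> {1..n}"
    "subst_vertices R vs xs ` s = set xs"
proof -
  have "subst_vertices R vs xs v \<in> block R v" if "v \<in> {1..r}" for v
    using subst_vertices_block[of xs R vs v] assms vs_props R that by (auto simp: As)
  then show "strict_mono_on {1..r} (subst_vertices R vs xs)" "subst_vertices R vs xs ` {1..r} \<subseteq> {1..n}"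
    using block_map[of r _ R n] R by auto
  show "subst_vertices R vs xs ` s = set xs"
    using subst_vertices_image[of vs xs R] vs_props assms by (auto simp: in_listset_iff)
qed

lemma set_xs_dsubsets:
  assumes "xs \<in> listset As"
  shows "set xs \<in> dsubsets {1..n} d"
  using dsubsets_image[OF strict_mono_on_imp_inj_on[OF subst_map(1)[OF assms]] subst_map(2)[OF assms] s]
  by (simp add: subst_map(3)[OF assms])

text \<open>Sorting each pair gives an increasing map from \<open>{1..2 * d}\<close> that carries
  the box into the set of corners of \<open>ps\<close>. Spreadability then compares with the box
  itself.\<close>

lemma prob_corners_le:
  assumes ps: "ps \<in> listset (map (\<lambda>A. A \<times> A) As)" and neq: "\<forall>p\<in>set ps. fst p \<noteq> snd p"
  shows "prob {\<omega> \<in> space M. \<forall>xs\<in>listset (map (\<lambda>(x, y). {x, y}) ps). X (set xs) \<omega> = a}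
    \<le> prob {\<omega> \<in> space M. \<forall>t\<in>Box n d. X t \<omega> = a} + \<eta>"
proof -
  \<comment> \<open>The vertices \<open>2 * i + 1\<close> and \<open>2 * i + 2\<close> go to the
    smaller and the larger point of the pair at position \<open>i\<close>.\<close>
  define \<psi> where "\<psi> j = (let p = ps ! ((j - 1) div 2) in
    if odd j then min (fst p) (snd p) else max (fst p) (snd p))" for j
  have len: "length ps = d" using ps vs_props by (simp add: in_listset_iff)
  have psi: "fst (ps ! i) \<in> block R (vs ! i)" "snd (ps ! i) \<in> block R (vs ! i)" "fst (ps ! i) \<noteq> snd (ps ! i)"
    if "i < d" for i
    using ps neq len that vs_props(4) by (auto simp: in_listset_iff As)
  have \<psi>_mem: "\<psi> j \<in> {fst (ps ! ((j - 1) div 2)), snd (ps ! ((j - 1) div 2))}" for j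
    by (auto simp: \<psi>_def Let_def min_def max_def)
  have half: "(j - 1) div 2 < d" if "j \<in> {1..2 * d}" for j using that by auto
  have \<psi>_block: "\<psi> j \<in> block R (vs ! ((j - 1) div 2))" if "j \<in> {1..2 * d}" for j
    using \<psi>_mem[of j] psi[OF half[OF that]] by auto
  have mono: "strict_mono_on {1..2 * d} \<psi>"
  proof (rule strict_mono_onI)
    fix i j assume ij: "i \<in> {1..2 * d}" "j \<in> {1..2 * d}" "i < j"
    then have le: "(i - 1) div 2 \<le> (j - 1) div 2" by (intro div_le_mono) auto
    show "\<psi> i < \<psi> j"
    proof (cases "(i - 1) div 2 = (j - 1) div 2")
      case True
      moreover obtain i' j' where "i = Suc i'" "j = Suc j'" using ij by (cases i; cases j) auto
      ultimately have "odd i \<and> even j" using half_eq_less_parity[of i' j'] ij(3) by simp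
      moreover note True psi(3)[OF half[OF ij(1)]]
      ultimately show ?thesis by (auto simp: \<psi>_def Let_def min_def max_def)
    next
      case False
      then show ?thesis
        using block_less[OF vs_props(9) \<psi>_block[OF ij(1)] \<psi>_block[OF ij(2)]] le half[OF ij(2)] by auto
    qed
  qed
  have img: "\<psi> ` {1..2 * d} \<subseteq> {1..n}"
  proof (rule image_subsetI)
    fix j assume j: "j \<in> {1..2 * d}"
    show "\<psi> j \<in> {1..n}"
      using \<psi>_block[OF j] block_subset[OF conjunct2[OF vs_props(8)[OF half[OF j]]] R(2)] by blast
  qed
  have Box: "Box n d \<subseteq> dsubsets {1..2 * d} d"
  proof
    fix t assume t: "t \<in> Box n d"
    have "pick {i. 2 * i + 1 \<in> t} ` {..<d} \<subseteq> {1..2 * d}" by (auto simp: pick_def)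
    then show "t \<in> dsubsets {1..2 * d} d"
      using t Box_eq_pick[OF t] by (auto simp: dsubsets_def Box_iff)
  qed
  have finB: "finite (Box n d)" using Box by (rule finite_subset) (simp add: finite_dsubsets)
  have m: "\<psi> ` t \<in> dsubsets {1..n} d" if "t \<in> Box n d" for t
    using dsubsets_image[OF strict_mono_on_imp_inj_on[OF mono] img] Box that by blast
  have "prob {\<omega> \<in> space M. \<forall>xs\<in>listset (map (\<lambda>(x, y). {x, y}) ps). X (set xs) \<omega> = a}
      \<le> prob {\<omega> \<in> space M. \<forall>t\<in>Box n d. X (\<psi> ` t) \<omega> = a}"
  proof (rule finite_measure_mono)
    show "{\<omega> \<in> space M. \<forall>t\<in>Box n d. X (\<psi> ` t) \<omega> = a} \<in> events"
      using finB m by (rule sets_X_all_eq)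
    show "{\<omega> \<in> space M. \<forall>xs\<in>listset (map (\<lambda>(x, y). {x, y}) ps). X (set xs) \<omega> = a}
      \<subseteq> {\<omega> \<in> space M. \<forall>t\<in>Box n d. X (\<psi> ` t) \<omega> = a}"
    proof safe
      fix \<omega> t assume \<omega>: "\<forall>xs\<in>listset (map (\<lambda>(x, y). {x, y}) ps). X (set xs) \<omega> = a" and t: "t \<in> Box n d"
      \<comment> \<open>The corner of \<open>ps\<close> whose point set is the image of the box
        element \<open>t\<close>.\<close>
      define xs where "xs = map (\<lambda>i. \<psi> (pick {i. 2 * i + 1 \<in> t} i)) [0..<d]"
      have h: "(pick S i - 1) div 2 = i" for S i by (auto simp: pick_def)
      have "\<psi> (pick S i) \<in> {fst (ps ! i), snd (ps ! i)}" for S i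
        using \<psi>_mem[of "pick S i"] unfolding h .
      then have "xs \<in> listset (map (\<lambda>(x, y). {x, y}) ps)"
        using len by (simp add: in_listset_iff xs_def split_def)
      moreover have "set xs = \<psi> ` t"
        by (subst Box_eq_pick[OF t]) (simp add: xs_def image_image lessThan_atLeast0)
      ultimately show "X (\<psi> ` t) \<omega> = a" using \<omega> by metis
    qed
  qed
  also have "\<dots> \<le> prob {\<omega> \<in> space M. \<forall>t\<in>Box n d. X t \<omega> = a} + \<eta>"
    using spread_event[OF _ dn mono img Box, of "\<lambda>_. a"] by linarith
  finally show ?thesis .
qed

text \<open>Lists of pairs without coincidence are copies of the box; those with a coincidence have
  density at most \<open>d / R\<close>.\<close>

lemma expectation_boxavg_le:
  "expectation (\<lambda>\<omega>. boxavg As (\<lambda>xs. of_bool (X (set xs) \<omega> = a)))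
    \<le> prob {\<omega> \<in> space M. \<forall>t\<in>Box n d. X t \<omega> = a} + \<eta> + real d / real R"
proof -
  let ?P = "map (\<lambda>A. A \<times> A) As"
  let ?E = "\<lambda>ps. {\<omega> \<in> space M. \<forall>xs\<in>listset (map (\<lambda>(x, y). {x, y}) ps). X (set xs) \<omega> = a}"
  have fin: "finite (listset (map (\<lambda>(x, y). {x, y}) ps))" for ps :: "(nat \<times> nat) list"
    by (induction ps) (auto simp: set_Cons_def intro!: finite_image_set2)
  have ev: "?E ps \<in> events" if ps: "ps \<in> listset ?P" for ps
  proof (rule sets_X_all_eq[OF fin])
    fix xs assume "xs \<in> listset (map (\<lambda>(x, y). {x, y}) ps)"
    then have "xs \<in> listset As" using ps by (fastforce simp: in_listset_iff split_def)
    then show "set xs \<in> dsubsets {1..n} d" by (rule set_xs_dsubsets)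
  qed
  have ind: "of_bool (\<forall>xs\<in>listset (map (\<lambda>(x, y). {x, y}) ps). X (set xs) \<omega> = a) = (indicator (?E ps) \<omega> :: real)"
    if "\<omega> \<in> space M" for \<omega> ps using that by (simp add: indicator_def)
  have "expectation (\<lambda>\<omega>. boxavg As (\<lambda>xs. of_bool (X (set xs) \<omega> = a)))
     = expectation (\<lambda>\<omega>. avg ?P (\<lambda>ps. indicator (?E ps) \<omega>))"
    unfolding boxavg_of_bool by (intro Bochner_Integration.integral_cong refl) (simp only: ind)
  also have "\<dots> = avg ?P (\<lambda>ps. expectation (indicator (?E ps)))"
    by (rule conjunct2[OF integral_avg]) (use ev in \<open>simp add: integrable_indicator_iff emeasure_eq_measure\<close>)
  also have "\<dots> = avg ?P (\<lambda>ps. prob (?E ps))"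
    by (rule avg_cong) (use ev in simp)
  also have "\<dots> \<le> (prob {\<omega> \<in> space M. \<forall>t\<in>Box n d. X t \<omega> = a} + \<eta>) + real (length As) / real R"
    by (rule avg_pairs_le[OF As_card R(1)]) (use prob_corners_le eta_nonneg dn in \<open>auto intro!: add_nonneg_nonneg\<close>)
  finally show ?thesis using vs_props(6) by simp
qed

end

text \<open>One \<open>\<eta>\<close> comes from the box hypothesis, and one from each of the
  \<open>2 ^ d\<close> factors when it is replaced by \<open>marg a\<close>.\<close>

lemma prob_Box_le:
  assumes dn: "2 * d \<le> n"
    and box: "\<bar>prob {\<omega> \<in> space M. \<forall>s\<in>Box n d. X s \<omega> = a}
      - (\<Prod>s\<in>Box n d. prob {\<omega> \<in> space M. X s \<omega> = a})\<bar> \<le> \<eta>"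
  shows "prob {\<omega> \<in> space M. \<forall>s\<in>Box n d. X s \<omega> = a} \<le> marg a ^ 2 ^ d + (1 + 2 ^ d) * \<eta>"
proof -
  have fin: "finite (Box n d)"
    by (rule finite_subset[of _ "dsubsets {1..n} d"]) (auto simp: Box_def finite_dsubsets)
  have "prob {\<omega> \<in> space M. X s \<omega> = a} \<le> marg a + \<eta>" if "s \<in> Box n d" for s
    using prob_eq_marg[of s a] that by (auto simp: Box_def)
  then have "(\<Prod>s\<in>Box n d. prob {\<omega> \<in> space M. X s \<omega> = a}) \<le> marg a ^ 2 ^ d + real (2 ^ d) * \<eta>"
    using prod_le_power_plus[OF fin, of "\<lambda>s. prob {\<omega> \<in> space M. X s \<omega> = a}" "marg a" \<eta>]
      marg_nonneg marg_le_1 eta_nonneg dn by (simp add: card_Box)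
  with box show ?thesis by (simp add: algebra_simps)
qed

text \<open>Clarkson's inequality for the indicator \<open>W\<close> of \<open>X = a\<close> and the constant \<open>p\<close>: the box average of
  \<open>W\<close> is at most about \<open>p ^ q\<close> by box independence, while that of \<open>W + p\<close> is at least about
  \<open>(2 * p) ^ q\<close> by convexity, so that of \<open>W - p\<close> is small, with a linear loss.\<close>
lemma expectation_boxavg_diff_le:
  assumes s: "s \<in> dsubsets {1..r} d" and R: "R > 0" "R * r \<le> n" and dn: "2 * d \<le> n"
    and As: "As = map (block R) (sorted_list_of_set s)"
    and box: "\<bar>prob {\<omega> \<in> space M. \<forall>s\<in>Box n d. X s \<omega> = a}
      - (\<Prod>s\<in>Box n d. prob {\<omega> \<in> space M. X s \<omega> = a})\<bar> \<le> \<eta>"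
  shows "2 * expectation (\<lambda>\<omega>. boxavg As (\<lambda>xs. of_bool (X (set xs) \<omega> = a) - marg a))
    \<le> 2 ^ 2 ^ d * ((2 + 2 * 2 ^ d) * \<eta> + real d / real R)"
proof -
  note ctx = s R dn refl As
  define q where "q = (2::nat) ^ d"
  define p where "p = marg a"
  have p: "0 \<le> p" "p \<le> 1" by (auto simp: p_def marg_nonneg marg_le_1)
  define W where "W \<omega> xs = (of_bool (X (set xs) \<omega> = a) :: real)" for \<omega> xs
  have len: "length As = d" and fin: "\<forall>A\<in>set As. finite A \<and> A \<noteq> {}"
    using vs_props(6)[OF ctx] As_finite[OF ctx] by auto
  have ne: "As \<noteq> []" using len d_pos by auto
  have Wm: "(\<lambda>\<omega>. W \<omega> xs) \<in> borel_measurable M" if "xs \<in> listset As" for xs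
  proof -
    have "(\<lambda>\<omega>. indicator {\<omega> \<in> space M. X (set xs) \<omega> = a} \<omega> :: real) \<in> borel_measurable M"
      using sets_X_eq[OF set_xs_dsubsets[OF ctx that]] by measurable
    then show ?thesis
      by (rule measurable_cong[THEN iffD1, rotated]) (simp add: W_def indicator_def)
  qed
  have int: "integrable M (\<lambda>\<omega>. boxavg As (\<lambda>xs. c * W \<omega> xs + e))" for c e
  proof (rule integrable_const_bound)
    show "AE \<omega> in M. norm (boxavg As (\<lambda>xs. c * W \<omega> xs + e)) \<le> (\<bar>c\<bar> + \<bar>e\<bar>) ^ 2 ^ length As"
      unfolding real_norm_def
      by (intro AE_I2 boxavg_abs_le fin) (auto simp: W_def intro: order_trans[OF abs_triangle_ineq])
    show "(\<lambda>\<omega>. boxavg As (\<lambda>xs. c * W \<omega> xs + e)) \<in> borel_measurable M"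
      by (intro boxavg_measurable borel_measurable_add borel_measurable_times borel_measurable_const Wm)
  qed
  have intW: "integrable M (\<lambda>\<omega>. W \<omega> xs)" if "xs \<in> listset As" for xs
    by (rule integrable_const_bound[of _ 1]) (use Wm that in \<open>auto simp: W_def\<close>)
  have EW: "expectation (\<lambda>\<omega>. W \<omega> xs) \<ge> p - \<eta>" if "xs \<in> listset As" for xs
  proof -
    have "expectation (\<lambda>\<omega>. W \<omega> xs) = expectation (indicator {\<omega> \<in> space M. X (set xs) \<omega> = a})"
      by (intro Bochner_Integration.integral_cong) (auto simp: W_def)
    also have "\<dots> = prob {\<omega> \<in> space M. X (set xs) \<omega> = a}"
      using sets_X_eq[OF set_xs_dsubsets[OF ctx that]] by simp
    finally show ?thesis using prob_eq_marg[OF set_xs_dsubsets[OF ctx that], of a] by (simp add: p_def)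
  qed
  obtain m where m: "q = Suc m" unfolding q_def by (metis not0_implies_Suc power_not_zero zero_neq_numeral)
  \<comment> \<open>The box average of \<open>W + p\<close> dominates the \<open>q\<close>-th power
    of its mean, which lies above its tangent at \<open>2 * p\<close>. The tangent is affine in the
    mean of \<open>W\<close>, so first moments suffice.\<close>
  have tangent: "(2 * p) ^ q + real q * (2 * p) ^ m * (avg As (W \<omega>) - p) \<le> boxavg As (\<lambda>xs. W \<omega> xs + p)" for \<omega>
  proof -
    have "avg As (\<lambda>xs. (W \<omega> xs + p) * 1) ^ q \<le> boxavg As (\<lambda>xs. W \<omega> xs + p)"
      unfolding q_def len[symmetric] by (rule avg_cylinder_prod_le[OF cylinder_prod_one fin])
    moreover have "avg As (\<lambda>xs. (W \<omega> xs + p) * 1) = avg As (W \<omega>) + p"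
      by (simp add: avg_add avg_const[OF fin])
    moreover have "0 \<le> avg As (W \<omega>)"
      using avg_mono[of As "\<lambda>_. 0" "W \<omega>"] avg_const[OF fin, of 0] by (simp add: W_def)
    ultimately show ?thesis
      using power_ge_tangent[of "avg As (W \<omega>) + p" "2 * p" m] p m by simp
  qed
  have "(2 * p) ^ q - real q * 2 ^ m * \<eta> \<le> (2 * p) ^ q + real q * (2 * p) ^ m * (- \<eta>)"
    using p eta_nonneg dn power_mono[of "2 * p" 2 m] by (simp add: mult_right_mono mult_left_mono)
  also have "\<dots> \<le> (2 * p) ^ q + real q * (2 * p) ^ m * (avg As (\<lambda>xs. expectation (\<lambda>\<omega>. W \<omega> xs)) - p)"
  proof -
    have "avg As (\<lambda>_. p - \<eta>) \<le> avg As (\<lambda>xs. expectation (\<lambda>\<omega>. W \<omega> xs))"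
      by (rule avg_mono) (rule EW)
    then show ?thesis using p by (intro add_mono mult_left_mono) (auto simp: avg_const[OF fin])
  qed
  also have "\<dots> = expectation (\<lambda>\<omega>. (2 * p) ^ q + real q * (2 * p) ^ m * (avg As (W \<omega>) - p))"
    using integral_avg[of As M W, OF intW] by (simp add: prob_space)
  also have "\<dots> \<le> expectation (\<lambda>\<omega>. boxavg As (\<lambda>xs. W \<omega> xs + p))"
    using integral_avg[of As M W, OF intW] int[of 1 p] tangent by (intro integral_mono) auto
  finally have lower: "(2 * p) ^ q - real q * 2 ^ m * \<eta> \<le> expectation (\<lambda>\<omega>. boxavg As (\<lambda>xs. W \<omega> xs + p))" .
  have upper: "expectation (\<lambda>\<omega>. boxavg As (W \<omega>)) \<le> p ^ q + (2 + real q) * \<eta> + real d / real R"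
    using expectation_boxavg_le[OF ctx, of a] prob_Box_le[OF dn box]
    by (simp add: W_def[abs_def] p_def q_def algebra_simps)
  have "2 * (boxavg As (\<lambda>xs. W \<omega> xs + p) + boxavg As (\<lambda>xs. W \<omega> xs - p)) \<le> 2 ^ q * (boxavg As (W \<omega>) + p ^ q)" for \<omega>
    using boxavg_clarkson[OF ne, of "W \<omega>" "\<lambda>_. p"] by (simp add: boxavg_const[OF fin] len q_def)
  then have "expectation (\<lambda>\<omega>. 2 * (boxavg As (\<lambda>xs. W \<omega> xs + p) + boxavg As (\<lambda>xs. W \<omega> xs - p)))
      \<le> expectation (\<lambda>\<omega>. 2 ^ q * (boxavg As (W \<omega>) + p ^ q))"
    using int[of 1 p] int[of 1 "-p"] int[of 1 0] by (intro integral_mono) auto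
  then have "2 * (expectation (\<lambda>\<omega>. boxavg As (\<lambda>xs. W \<omega> xs + p)) + expectation (\<lambda>\<omega>. boxavg As (\<lambda>xs. W \<omega> xs - p)))
      \<le> 2 ^ q * (expectation (\<lambda>\<omega>. boxavg As (W \<omega>)) + p ^ q)"
    using int[of 1 p] int[of 1 "-p"] int[of 1 0] by (simp add: prob_space)
  also have "\<dots> \<le> 2 ^ q * (p ^ q + (2 + real q) * \<eta> + real d / real R + p ^ q)"
    using upper by (intro mult_left_mono) auto
  finally have "2 * expectation (\<lambda>\<omega>. boxavg As (\<lambda>xs. W \<omega> xs - p)) \<le>
     2 ^ q * (p ^ q + (2 + real q) * \<eta> + real d / real R + p ^ q) - 2 * ((2 * p) ^ q - real q * 2 ^ m * \<eta>)"
    using lower by simp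
  \<comment> \<open>The main terms \<open>2 ^ q * (2 * p ^ q)\<close> and
    \<open>2 * (2 * p) ^ q\<close> cancel, and \<open>2 * q * 2 ^ m = q * 2 ^ q\<close> turns the
    coefficient \<open>2 + q\<close> into \<open>2 + 2 * q\<close>.\<close>
  also have "\<dots> = 2 ^ q * ((2 + 2 * real q) * \<eta> + real d / real R)"
    by (simp add: m power_mult_distrib algebra_simps)
  finally show ?thesis by (simp add: W_def p_def q_def)
qed

text \<open>Each copy of the configuration inside the blow-up has nearly the same covariance, so
  this covariance is nearly the expected average of \<open>W - p\<close> against the indicator of
  the copied event on \<open>T\<close>. That indicator is a cylinder product, so the centred box
  average controls the result. Extracting the root gives \<open>2 * x\<close>; transport to the
  copies costs \<open>2 * \<eta>\<close>.\<close>

lemma prob_insert_eq: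
  assumes s: "s \<in> dsubsets {1..r} d" and T: "T \<subseteq> dsubsets {1..r} d" "s \<notin> T"
    and R: "R > 0" "R * r \<le> n" and dr: "2 * d \<le> n" "d \<le> r"
    and box: "\<bar>prob {\<omega> \<in> space M. \<forall>s\<in>Box n d. X s \<omega> = a}
      - (\<Prod>s\<in>Box n d. prob {\<omega> \<in> space M. X s \<omega> = a})\<bar> \<le> \<eta>"
    and x: "0 \<le> x" "(2 + 2 * 2 ^ d) * \<eta> + real d / real R \<le> x ^ 2 ^ d"
  shows "\<bar>prob {\<omega> \<in> space M. X s \<omega> = a \<and> (\<forall>t\<in>T. X t \<omega> = b t)} - marg a * prob {\<omega> \<in> space M. \<forall>t\<in>T. X t \<omega> = b t}\<bar>
    \<le> 2 * x + 2 * \<eta>"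
proof -
  define vs where "vs = sorted_list_of_set s"
  define As where "As = map (block R) vs"
  note ctx = s R dr(1) vs_def As_def
  define p where "p = marg a"
  have p: "0 \<le> p" "p \<le> 1" by (auto simp: p_def marg_nonneg marg_le_1)
  have len: "length As = d" and fin: "\<forall>A\<in>set As. finite A \<and> A \<noteq> {}"
    using vs_props(6)[OF ctx] As_finite[OF ctx] by auto
  have rn: "r \<le> n" using R by (metis Suc_leI mult.left_neutral mult_le_mono1 order_trans One_nat_def)
  have finT: "finite T" using T(1) by (rule finite_subset) (simp add: finite_dsubsets)
  define \<psi> where "\<psi> = subst_vertices R vs"
  define W where "W \<omega> xs = (of_bool (X (set xs) \<omega> = a) :: real)" for \<omega> xs
  define \<Phi> where "\<Phi> \<omega> xs = (\<Prod>t\<in>T. of_bool (X (\<psi> xs ` t) \<omega> = b t) :: real)" for \<omega> xs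
  define h where "h \<omega> = avg As (\<lambda>xs. (W \<omega> xs - p) * \<Phi> \<omega> xs)" for \<omega>
  define D where "D = prob {\<omega> \<in> space M. X s \<omega> = a \<and> (\<forall>t\<in>T. X t \<omega> = b t)} - p * prob {\<omega> \<in> space M. \<forall>t\<in>T. X t \<omega> = b t}"
  have cyl: "cylinder_prod (length As) (\<Phi> \<omega>)" for \<omega>
    unfolding \<Phi>_def
  proof (rule cylinder_prod_prod[OF finT])
    fix t assume t: "t \<in> T"
    \<comment> \<open>Distinct sets of equal size: \<open>t\<close> misses some vertex of
      \<open>s\<close>, and the factor of \<open>t\<close> does not change when that vertex moves in
      its block.\<close>
    have "\<not> s \<subseteq> t"
    proof
      assume "s \<subseteq> t"
      moreover have "finite t" "card t = card s" using t T s by (auto simp: dsubsets_def intro: finite_subset)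
      ultimately have "s = t" by (intro card_subset_eq) auto
      with t T show False by simp
    qed
    then obtain i where i: "i < d" "vs ! i \<notin> t"
      using vs_props(2,4)[OF ctx] by (metis in_set_conv_nth subsetI)
    show "cylinder_prod (length As) (\<lambda>xs. of_bool (X (\<psi> xs ` t) \<omega> = b t))"
    proof (rule cylinder_prod_single[of i])
      fix xs y
      have "\<psi> (xs[i := y]) ` t = \<psi> xs ` t"
        unfolding \<psi>_def using i vs_props(3,4)[OF ctx] by (intro image_cong subst_vertices_update) auto
      then show "(of_bool (X (\<psi> (xs[i := y]) ` t) \<omega> = b t) :: real) = of_bool (X (\<psi> xs ` t) \<omega> = b t)"
        by simp
    qed (use i len in auto)
  qed
  have \<Phi>_of_bool: "\<Phi> \<omega> xs = of_bool (\<forall>t\<in>T. X (\<psi> xs ` t) \<omega> = b t)" for \<omega> xs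
    unfolding \<Phi>_def using finT by (induction T) auto
  let ?E = "\<lambda>xs. {\<omega> \<in> space M. \<forall>t\<in>T. X (\<psi> xs ` t) \<omega> = b t}"
  let ?E' = "\<lambda>xs. {\<omega> \<in> space M. \<forall>t\<in>insert s T. X (\<psi> xs ` t) \<omega> = (b(s := a)) t}"
  have mem: "\<psi> xs ` t \<in> dsubsets {1..n} d" if "xs \<in> listset As" "t \<in> dsubsets {1..r} d" for xs t
    using dsubsets_image[OF strict_mono_on_imp_inj_on] subst_map[OF ctx that(1)] that(2) unfolding \<psi>_def by blast
  have ev: "?E xs \<in> events" "?E' xs \<in> events" if "xs \<in> listset As" for xs
    by (rule sets_X_all_eq; use finT T s mem that in blast)+
  have integrand: "(W \<omega> xs - p) * \<Phi> \<omega> xs = indicator (?E' xs) \<omega> - p * indicator (?E xs) \<omega>"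
    if "xs \<in> listset As" "\<omega> \<in> space M" for xs \<omega>
    using that T(2) subst_map(3)[OF ctx that(1)]
    by (auto simp: W_def \<Phi>_of_bool indicator_def \<psi>_def)
  have int: "integrable M (\<lambda>\<omega>. (W \<omega> xs - p) * \<Phi> \<omega> xs)"
    and val: "\<bar>expectation (\<lambda>\<omega>. (W \<omega> xs - p) * \<Phi> \<omega> xs) - D\<bar> \<le> 2 * \<eta>" if xs: "xs \<in> listset As" for xs
  proof -
    have i: "integrable M (\<lambda>\<omega>. indicator (?E' xs) \<omega> - p * indicator (?E xs) \<omega>)"
      using ev[OF xs] by (auto simp: emeasure_eq_measure)
    show "integrable M (\<lambda>\<omega>. (W \<omega> xs - p) * \<Phi> \<omega> xs)"
      by (rule Bochner_Integration.integrable_cong[THEN iffD1, OF refl _ i]) (simp only: integrand[OF xs])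
    have "expectation (\<lambda>\<omega>. (W \<omega> xs - p) * \<Phi> \<omega> xs) = expectation (\<lambda>\<omega>. indicator (?E' xs) \<omega> - p * indicator (?E xs) \<omega>)"
      by (rule Bochner_Integration.integral_cong[OF refl]) (simp only: integrand[OF xs])
    also have "\<dots> = prob (?E' xs) - p * prob (?E xs)"
      using ev[OF xs] by (subst Bochner_Integration.integral_diff) (auto simp: emeasure_eq_measure)
    finally have E: "expectation (\<lambda>\<omega>. (W \<omega> xs - p) * \<Phi> \<omega> xs) = prob (?E' xs) - p * prob (?E xs)" .
    note sp = spread_event[OF dr(2) rn subst_map(1,2)[OF ctx xs]]
    have "\<bar>prob {\<omega> \<in> space M. \<forall>t\<in>insert s T. X t \<omega> = (b(s := a)) t} - prob (?E' xs)\<bar> \<le> \<eta>"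
      unfolding \<psi>_def by (rule sp) (use s T in auto)
    also have "{\<omega> \<in> space M. \<forall>t\<in>insert s T. X t \<omega> = (b(s := a)) t} = {\<omega> \<in> space M. X s \<omega> = a \<and> (\<forall>t\<in>T. X t \<omega> = b t)}"
      using T(2) by auto
    finally have "\<bar>prob {\<omega> \<in> space M. X s \<omega> = a \<and> (\<forall>t\<in>T. X t \<omega> = b t)} - prob (?E' xs)\<bar> \<le> \<eta>" .
    moreover have "\<bar>prob {\<omega> \<in> space M. \<forall>t\<in>T. X t \<omega> = b t} - prob (?E xs)\<bar> \<le> \<eta>"
      unfolding \<psi>_def by (rule sp) (use T in auto)
    then have "\<bar>p * prob {\<omega> \<in> space M. \<forall>t\<in>T. X t \<omega> = b t} - p * prob (?E xs)\<bar> \<le> 1 * \<eta>"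
      unfolding right_diff_distrib[symmetric] abs_mult using p by (intro mult_mono) auto
    ultimately show "\<bar>expectation (\<lambda>\<omega>. (W \<omega> xs - p) * \<Phi> \<omega> xs) - D\<bar> \<le> 2 * \<eta>"
      unfolding E D_def by linarith
  qed
  have Eh: "expectation h = avg As (\<lambda>xs. expectation (\<lambda>\<omega>. (W \<omega> xs - p) * \<Phi> \<omega> xs))" and inth: "integrable M h"
    using integral_avg[of As M "\<lambda>\<omega> xs. (W \<omega> xs - p) * \<Phi> \<omega> xs", OF int] by (auto simp: h_def[abs_def])
  have "avg As (\<lambda>_. D - 2 * \<eta>) \<le> expectation h"
    unfolding Eh by (rule avg_mono) (use val in \<open>force simp: abs_le_iff\<close>)
  moreover have "expectation h \<le> avg As (\<lambda>_. D + 2 * \<eta>)"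
    unfolding Eh by (rule avg_mono) (use val in \<open>force simp: abs_le_iff\<close>)
  ultimately have close: "\<bar>expectation h - D\<bar> \<le> 2 * \<eta>"
    by (simp add: avg_const[OF fin])
  have hle: "h \<omega> ^ 2 ^ d \<le> boxavg As (\<lambda>xs. W \<omega> xs - p)" for \<omega>
    unfolding h_def len[symmetric] by (rule avg_cylinder_prod_le[OF cyl fin])
  have Wm: "(\<lambda>\<omega>. W \<omega> xs - p) \<in> borel_measurable M" if "xs \<in> listset As" for xs
  proof -
    have "(\<lambda>\<omega>. indicator {\<omega> \<in> space M. X (set xs) \<omega> = a} \<omega> - p :: real) \<in> borel_measurable M"
      using sets_X_eq[OF set_xs_dsubsets[OF ctx that]] by measurable
    then show ?thesis
      by (rule measurable_cong[THEN iffD1, rotated]) (simp add: W_def indicator_def)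
  qed
  have intB: "integrable M (\<lambda>\<omega>. boxavg As (\<lambda>xs. W \<omega> xs - p))"
  proof (rule integrable_const_bound)
    show "AE \<omega> in M. norm (boxavg As (\<lambda>xs. W \<omega> xs - p)) \<le> 1 ^ 2 ^ length As"
      unfolding real_norm_def using p
      by (intro AE_I2 boxavg_abs_le fin) (auto simp: W_def)
    show "(\<lambda>\<omega>. boxavg As (\<lambda>xs. W \<omega> xs - p)) \<in> borel_measurable M"
      by (intro boxavg_measurable Wm)
  qed
  have hbound: "\<bar>h \<omega>\<bar> \<le> 1" for \<omega>
  proof -
    have "\<bar>(W \<omega> xs - p) * \<Phi> \<omega> xs\<bar> \<le> 1" for xs using p by (auto simp: W_def \<Phi>_of_bool)
    then have "-1 \<le> (W \<omega> xs - p) * \<Phi> \<omega> xs" "(W \<omega> xs - p) * \<Phi> \<omega> xs \<le> 1" for xs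
      by (auto simp: abs_le_iff minus_le_iff)
    then have "avg As (\<lambda>_. -1) \<le> h \<omega>" "h \<omega> \<le> avg As (\<lambda>_. 1)"
      unfolding h_def by (auto intro!: avg_mono)
    then show ?thesis by (simp add: avg_const[OF fin])
  qed
  have hm: "h \<in> borel_measurable M" using inth by auto
  \<comment> \<open>The exponent is even because \<open>d \<ge> 1\<close>.\<close>
  have "\<bar>expectation h\<bar> ^ 2 ^ d = expectation h ^ 2 ^ d"
    using d_pos by (simp add: power_even_abs)
  also have "\<dots> \<le> expectation (\<lambda>\<omega>. h \<omega> ^ 2 ^ d)"
    by (rule expectation_power_2pow_le[OF hm hbound])
  also have "\<dots> \<le> expectation (\<lambda>\<omega>. boxavg As (\<lambda>xs. W \<omega> xs - p))"
  proof (rule integral_mono[OF _ intB hle])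
    show "integrable M (\<lambda>\<omega>. h \<omega> ^ 2 ^ d)"
      by (rule integrable_const_bound[of _ 1]) (use hm hbound in \<open>auto simp: power_abs power_le_one\<close>)
  qed
  also have "\<dots> \<le> 2 ^ 2 ^ d * ((2 + 2 * 2 ^ d) * \<eta> + real d / real R)"
  proof -
    \<comment> \<open>Positivity allows the factor 2 on the left of the Clarkson estimate to be
      dropped.\<close>
    have "0 \<le> expectation (\<lambda>\<omega>. boxavg As (\<lambda>xs. W \<omega> xs - p))"
      using len d_pos by (intro Bochner_Integration.integral_nonneg boxavg_nonneg) auto
    then show ?thesis
      using expectation_boxavg_diff_le[OF s R dr(1) As_def[unfolded vs_def] box] by (simp add: W_def p_def)
  qed
  also have "\<dots> \<le> (2 * x) ^ 2 ^ d"
    using x by (simp add: power_mult_distrib)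
  finally have "\<bar>expectation h\<bar> \<le> 2 * x"
    using power_mono_iff[of "\<bar>expectation h\<bar>" "2 * x" "2 ^ d"] x by simp
  with close show ?thesis unfolding D_def p_def by linarith
qed

end

section \<open>From single entries to subarrays on two intervals\<close>

lemma sum_PiE_insert:
  fixes F :: "('i \<Rightarrow> 'b) \<Rightarrow> real"
  assumes "s \<notin> D"
  shows "(\<Sum>b\<in>PiE (insert s D) (\<lambda>_. A). F b) = (\<Sum>b\<in>PiE D (\<lambda>_. A). \<Sum>a\<in>A. F (b(s := a)))"
proof -
  have "(\<Sum>b\<in>PiE (insert s D) (\<lambda>_. A). F b) = (\<Sum>(a, b)\<in>A \<times> PiE D (\<lambda>_. A). F (b(s := a)))"
    unfolding PiE_insert_eq using sum.reindex[OF inj_combinator[OF assms, of "\<lambda>_. A"], of F]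
    by (simp add: split_def comp_def)
  also have "\<dots> = (\<Sum>b\<in>PiE D (\<lambda>_. A). \<Sum>a\<in>A. F (b(s := a)))"
    by (subst sum.swap) (simp add: sum.cartesian_product)
  finally show ?thesis .
qed

text \<open>An assignment on two disjoint copies of \<open>D\<close> is a pair of assignments on
  \<open>D\<close>, and the product weight splits accordingly: Fubini for the product law.\<close>

lemma sum_PiE_two_copies:
  fixes u v :: "('i \<Rightarrow> 'b) \<Rightarrow> real"
  assumes "finite D" "inj_on \<sigma> D" "D \<inter> \<sigma> ` D = {}"
  shows "(\<Sum>b\<in>PiE (D \<union> \<sigma> ` D) (\<lambda>_. A). u (restrict b D) * v (\<lambda>t\<in>D. b (\<sigma> t)) * (\<Prod>t\<in>D \<union> \<sigma> ` D. w (b t)))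
    = (\<Sum>b\<in>PiE D (\<lambda>_. A). u b * (\<Prod>t\<in>D. w (b t))) * (\<Sum>b\<in>PiE D (\<lambda>_. A). v b * (\<Prod>t\<in>D. w (b t)))"
proof -
  let ?\<tau> = "the_inv_into D \<sigma>"
  let ?j = "\<lambda>(b1, b2). \<lambda>t\<in>D \<union> \<sigma> ` D. if t \<in> D then b1 t else b2 (?\<tau> t)"
  have \<sigma>: "\<sigma> t \<notin> D" "?\<tau> (\<sigma> t) = t" if "t \<in> D" for t
    using that assms by (auto simp: the_inv_into_f_f)
  have "(\<Sum>b\<in>PiE (D \<union> \<sigma> ` D) (\<lambda>_. A). u (restrict b D) * v (\<lambda>t\<in>D. b (\<sigma> t)) * (\<Prod>t\<in>D \<union> \<sigma> ` D. w (b t)))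
    = (\<Sum>(b1, b2)\<in>PiE D (\<lambda>_. A) \<times> PiE D (\<lambda>_. A). (u b1 * (\<Prod>t\<in>D. w (b1 t))) * (v b2 * (\<Prod>t\<in>D. w (b2 t))))"
  proof (rule sum.reindex_bij_witness[where i = ?j and j = "\<lambda>b. (restrict b D, \<lambda>t\<in>D. b (\<sigma> t))"])
    fix b assume b: "b \<in> PiE (D \<union> \<sigma> ` D) (\<lambda>_. A)"
    show "(restrict b D, \<lambda>t\<in>D. b (\<sigma> t)) \<in> PiE D (\<lambda>_. A) \<times> PiE D (\<lambda>_. A)"
      using b by auto
    show "?j (restrict b D, \<lambda>t\<in>D. b (\<sigma> t)) = b"
      using b \<sigma> by (auto simp: fun_eq_iff PiE_def extensional_def restrict_def)
    have "(\<Prod>t\<in>D \<union> \<sigma> ` D. w (b t)) = (\<Prod>t\<in>D. w (b t)) * (\<Prod>t\<in>D. w (b (\<sigma> t)))"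
      using assms by (subst prod.union_disjoint) (auto simp: prod.reindex)
    then show "(case (restrict b D, \<lambda>t\<in>D. b (\<sigma> t)) of (b1, b2) \<Rightarrow> (u b1 * (\<Prod>t\<in>D. w (b1 t))) * (v b2 * (\<Prod>t\<in>D. w (b2 t))))
       = u (restrict b D) * v (\<lambda>t\<in>D. b (\<sigma> t)) * (\<Prod>t\<in>D \<union> \<sigma> ` D. w (b t))"
      by simp
  next
    fix b assume "b \<in> PiE D (\<lambda>_. A) \<times> PiE D (\<lambda>_. A)"
    then obtain b1 b2 where b: "b = (b1, b2)" "b1 \<in> PiE D (\<lambda>_. A)" "b2 \<in> PiE D (\<lambda>_. A)" by auto
    show "?j b \<in> PiE (D \<union> \<sigma> ` D) (\<lambda>_. A)"
      using b \<sigma> by (auto simp: PiE_iff)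
    show "(restrict (?j b) D, \<lambda>t\<in>D. ?j b (\<sigma> t)) = b"
      using b \<sigma> by (auto simp: fun_eq_iff PiE_def extensional_def restrict_def)
  qed
  then show ?thesis by (simp add: sum_product sum.cartesian_product split_def)
qed

context spreadable_array
begin

context
  fixes S r R and x :: real
  assumes S: "S \<subseteq> \<X>" "card S = card \<X> - 1" "card \<X> \<ge> 1"
    and R: "R > 0" "R * r \<le> n" and dr: "2 * d \<le> n" "d \<le> r"
    and box: "\<And>a. a \<in> S \<Longrightarrow> \<bar>prob {\<omega> \<in> space M. \<forall>s\<in>Box n d. X s \<omega> = a}
      - (\<Prod>s\<in>Box n d. prob {\<omega> \<in> space M. X s \<omega> = a})\<bar> \<le> \<eta>"
    and x: "0 \<le> x" "(2 + 2 * 2 ^ d) * \<eta> + real d / real R \<le> x ^ 2 ^ d"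
begin

lemma r_le_n: "r \<le> n"
  using R by (metis Suc_leI mult.left_neutral mult_le_mono1 order_trans One_nat_def)

text \<open>The one value outside \<open>S\<close> is not covered by the box hypothesis. Summed over
  all values the deviations cancel, so its deviation is at most the sum of the others; hence the
  factor 2.\<close>

lemma sum_prob_insert_le:
  assumes s: "s \<in> dsubsets {1..r} d" and T: "T \<subseteq> dsubsets {1..r} d" "s \<notin> T"
  shows "(\<Sum>a\<in>\<X>. \<bar>prob {\<omega> \<in> space M. X s \<omega> = a \<and> (\<forall>t\<in>T. X t \<omega> = b t)} - marg a * prob {\<omega> \<in> space M. \<forall>t\<in>T. X t \<omega> = b t}\<bar>)
    \<le> 2 * (real (card \<X>) - 1) * (2 * x + 2 * \<eta>)"
proof -
  let ?A = "\<lambda>a. {\<omega> \<in> space M. X s \<omega> = a \<and> (\<forall>t\<in>T. X t \<omega> = b t)}"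
  let ?T = "{\<omega> \<in> space M. \<forall>t\<in>T. X t \<omega> = b t}"
  define D where "D a = prob (?A a) - marg a * prob ?T" for a
  have fS: "finite S" using S finite_X by (auto intro: finite_subset)
  have "card (\<X> - S) = 1" using S fS by (simp add: card_Diff_subset)
  then obtain a0 where a0: "\<X> - S = {a0}" by (auto simp: card_1_singleton_iff)
  then have X: "\<X> = insert a0 S" "a0 \<notin> S" using S by auto
  have finT: "finite T" using T(1) by (rule finite_subset) (simp add: finite_dsubsets)
  have sub: "dsubsets {1..r} d \<subseteq> dsubsets {1..n} d"
    using r_le_n by (auto simp: dsubsets_def)
  have ev: "?A a \<in> events" for a
  proof -
    have "?A a = {\<omega> \<in> space M. X s \<omega> = a} \<inter> ?T" by auto
    moreover have "\<dots> \<in> events"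
      by (intro sets.Int sets_X_eq sets_X_all_eq finT) (use s T sub in blast)+
    ultimately show ?thesis by simp
  qed
  have "(\<Sum>a\<in>\<X>. prob (?A a)) = prob (\<Union>a\<in>\<X>. ?A a)"
    by (rule finite_measure_finite_Union[symmetric])
      (use finite_X ev in \<open>auto simp: disjoint_family_on_def\<close>)
  also have "(\<Union>a\<in>\<X>. ?A a) = ?T"
    using X_val[of s] s sub by auto
  finally have "(\<Sum>a\<in>\<X>. D a) = 0"
    using sum_marg dr r_le_n by (simp add: D_def sum_subtractf flip: sum_distrib_right)
  then have "D a0 = - (\<Sum>a\<in>S. D a)" using X fS by simp
  then have "(\<Sum>a\<in>\<X>. \<bar>D a\<bar>) \<le> 2 * (\<Sum>a\<in>S. \<bar>D a\<bar>)"
    using X fS sum_abs[of D S] by simp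
  also have "\<dots> \<le> 2 * (\<Sum>a\<in>S. 2 * x + 2 * \<eta>)"
    unfolding D_def
    by (intro mult_left_mono sum_mono prob_insert_eq[OF s T R dr box x]) auto
  also have "\<dots> = 2 * (real (card \<X>) - 1) * (2 * x + 2 * \<eta>)"
    using S by (simp add: of_nat_diff)
  finally show ?thesis by (simp add: D_def)
qed

text \<open>Entries are added one at a time. A new entry costs a fixed amount for each assignment of
  the old ones, and the old error is not amplified because the weights \<open>marg a\<close> sum to
  1. The costs form a geometric sum.\<close>

lemma sum_prob_array_le:
  assumes "D \<subseteq> dsubsets {1..r} d"
  shows "(\<Sum>b\<in>PiE D (\<lambda>_. \<X>). \<bar>prob {\<omega> \<in> space M. \<forall>t\<in>D. X t \<omega> = b t} - (\<Prod>t\<in>D. marg (b t))\<bar>)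
    \<le> 2 * (2 * x + 2 * \<eta>) * (real (card \<X>) ^ card D - 1)"
proof -
  have "finite D" using assms by (rule finite_subset) (simp add: finite_dsubsets)
  then show ?thesis using assms
  proof (induction D)
    case empty
    then show ?case by (simp add: prob_space)
  next
    case (insert s D)
    let ?P = "\<lambda>b. prob {\<omega> \<in> space M. \<forall>t\<in>D. X t \<omega> = b t}"
    let ?Pi = "\<lambda>b. \<Prod>t\<in>D. marg (b t)"
    let ?e = "2 * x + 2 * \<eta>"
    have "(\<Sum>b\<in>PiE (insert s D) (\<lambda>_. \<X>). \<bar>prob {\<omega> \<in> space M. \<forall>t\<in>insert s D. X t \<omega> = b t} - (\<Prod>t\<in>insert s D. marg (b t))\<bar>)
      = (\<Sum>b\<in>PiE D (\<lambda>_. \<X>). \<Sum>a\<in>\<X>. \<bar>prob {\<omega> \<in> space M. X s \<omega> = a \<and> (\<forall>t\<in>D. X t \<omega> = b t)} - marg a * ?Pi b\<bar>)"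
      unfolding sum_PiE_insert[OF insert.hyps(2)]
    proof (intro sum.cong refl)
      fix b a
      have "(\<forall>t\<in>insert s D. X t \<omega> = (b(s := a)) t) \<longleftrightarrow> X s \<omega> = a \<and> (\<forall>t\<in>D. X t \<omega> = b t)" for \<omega>
        using insert.hyps by auto
      moreover have "(\<Prod>t\<in>insert s D. marg ((b(s := a)) t)) = marg a * ?Pi b"
        using insert.hyps by (subst prod.insert) (auto intro!: prod.cong)
      ultimately show "\<bar>prob {\<omega> \<in> space M. \<forall>t\<in>insert s D. X t \<omega> = (b(s := a)) t} - (\<Prod>t\<in>insert s D. marg ((b(s := a)) t))\<bar>
          = \<bar>prob {\<omega> \<in> space M. X s \<omega> = a \<and> (\<forall>t\<in>D. X t \<omega> = b t)} - marg a * ?Pi b\<bar>"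
        by simp
    qed
    also have "\<dots> \<le> (\<Sum>b\<in>PiE D (\<lambda>_. \<X>). 2 * (real (card \<X>) - 1) * ?e + \<bar>?P b - ?Pi b\<bar>)"
    proof (rule sum_mono)
      fix b
      have "(\<Sum>a\<in>\<X>. \<bar>prob {\<omega> \<in> space M. X s \<omega> = a \<and> (\<forall>t\<in>D. X t \<omega> = b t)} - marg a * ?Pi b\<bar>)
        \<le> (\<Sum>a\<in>\<X>. \<bar>prob {\<omega> \<in> space M. X s \<omega> = a \<and> (\<forall>t\<in>D. X t \<omega> = b t)} - marg a * ?P b\<bar>
            + marg a * \<bar>?P b - ?Pi b\<bar>)"
      proof (rule sum_mono)
        fix a
        have "\<bar>marg a * ?P b - marg a * ?Pi b\<bar> = marg a * \<bar>?P b - ?Pi b\<bar>"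
          using marg_nonneg[of a] by (simp add: abs_mult flip: right_diff_distrib)
        then show "\<bar>prob {\<omega> \<in> space M. X s \<omega> = a \<and> (\<forall>t\<in>D. X t \<omega> = b t)} - marg a * ?Pi b\<bar>
          \<le> \<bar>prob {\<omega> \<in> space M. X s \<omega> = a \<and> (\<forall>t\<in>D. X t \<omega> = b t)} - marg a * ?P b\<bar> + marg a * \<bar>?P b - ?Pi b\<bar>"
          by linarith
      qed
      also have "\<dots> \<le> 2 * (real (card \<X>) - 1) * ?e + \<bar>?P b - ?Pi b\<bar>"
        using sum_prob_insert_le[of s D b] insert.prems insert.hyps sum_marg dr r_le_n
        by (simp add: sum.distrib flip: sum_distrib_right)
      finally show "(\<Sum>a\<in>\<X>. \<bar>prob {\<omega> \<in> space M. X s \<omega> = a \<and> (\<forall>t\<in>D. X t \<omega> = b t)} - marg a * ?Pi b\<bar>)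
        \<le> 2 * (real (card \<X>) - 1) * ?e + \<bar>?P b - ?Pi b\<bar>" .
    qed
    also have "\<dots> \<le> real (card \<X>) ^ card D * (2 * (real (card \<X>) - 1) * ?e) + 2 * ?e * (real (card \<X>) ^ card D - 1)"
      using insert by (simp add: sum.distrib card_PiE)
    also have "\<dots> = 2 * ?e * (real (card \<X>) ^ card (insert s D) - 1)"
      using insert.hyps by (simp add: algebra_simps)
    finally show ?case .
  qed
qed

text \<open>A bounded \<open>G\<close> is paired with the l1 distance between the law of the array
  and the product law. Transport along \<open>\<psi>\<close> costs another \<open>\<eta>\<close> per
  value, whence \<open>5 * \<eta>\<close>.\<close>

lemma expectation_array_near_product:
  assumes D: "D \<subseteq> dsubsets {1..r} d" and \<psi>: "strict_mono_on {1..r} \<psi>" "\<psi> ` {1..r} \<subseteq> {1..n}"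
    and G: "\<And>b. \<bar>G b\<bar> \<le> B"
  shows "integrable M (\<lambda>\<omega>. G (\<lambda>t\<in>D. X (\<psi> ` t) \<omega>))"
    and "\<bar>expectation (\<lambda>\<omega>. G (\<lambda>t\<in>D. X (\<psi> ` t) \<omega>)) - (\<Sum>b\<in>PiE D (\<lambda>_. \<X>). G b * (\<Prod>t\<in>D. marg (b t)))\<bar>
      \<le> B * ((4 * x + 5 * \<eta>) * real (card \<X>) ^ card D)"
proof -
  let ?Pi = "PiE D (\<lambda>_. \<X>)"
  let ?E = "\<lambda>b. {\<omega> \<in> space M. \<forall>t\<in>D. X (\<psi> ` t) \<omega> = b t}"
  have finD: "finite D" using D by (rule finite_subset) (simp add: finite_dsubsets)
  have finPi: "finite ?Pi" using finD finite_X by (simp add: finite_PiE)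
  have B: "0 \<le> B" using G[of undefined] by linarith
  have mem: "\<psi> ` t \<in> dsubsets {1..n} d" if "t \<in> D" for t
    using dsubsets_image[OF strict_mono_on_imp_inj_on[OF \<psi>(1)] \<psi>(2)] D that by blast
  have ev: "?E b \<in> events" for b
    by (rule sets_X_all_eq[OF finD mem])
  have eq: "G (\<lambda>t\<in>D. X (\<psi> ` t) \<omega>) = (\<Sum>b\<in>?Pi. G b * indicator (?E b) \<omega>)" if \<omega>: "\<omega> \<in> space M" for \<omega>
  proof -
    let ?y = "\<lambda>t\<in>D. X (\<psi> ` t) \<omega>"
    have y: "?y \<in> ?Pi" using X_val mem \<omega> by auto
    have "indicator (?E b) \<omega> = (of_bool (b = ?y) :: real)" if "b \<in> ?Pi" for b
    proof -
      have "(\<forall>t\<in>D. X (\<psi> ` t) \<omega> = b t) \<longleftrightarrow> b = ?y"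
        using PiE_ext[OF that y] by auto
      then show ?thesis using \<omega> by (simp add: indicator_def)
    qed
    then have "(\<Sum>b\<in>?Pi. G b * indicator (?E b) \<omega>) = (\<Sum>b\<in>?Pi. G b * of_bool (b = ?y))"
      by (intro sum.cong) auto
    also have "\<dots> = G ?y" using y finPi by (simp add: sum.delta' of_bool_def if_distrib cong: if_cong)
    finally show ?thesis ..
  qed
  have int: "integrable M (\<lambda>\<omega>. \<Sum>b\<in>?Pi. G b * indicator (?E b) \<omega>)"
    using ev by (intro Bochner_Integration.integrable_sum integrable_mult_right) (auto simp: emeasure_eq_measure)
  then show "integrable M (\<lambda>\<omega>. G (\<lambda>t\<in>D. X (\<psi> ` t) \<omega>))"
    by (rule Bochner_Integration.integrable_cong[THEN iffD1, OF refl, rotated]) (simp only: eq)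
  have "expectation (\<lambda>\<omega>. G (\<lambda>t\<in>D. X (\<psi> ` t) \<omega>)) = expectation (\<lambda>\<omega>. \<Sum>b\<in>?Pi. G b * indicator (?E b) \<omega>)"
    by (rule Bochner_Integration.integral_cong[OF refl]) (simp only: eq)
  also have "\<dots> = (\<Sum>b\<in>?Pi. G b * prob (?E b))"
    using ev by (subst Bochner_Integration.integral_sum) (auto simp: emeasure_eq_measure)
  finally have E: "expectation (\<lambda>\<omega>. G (\<lambda>t\<in>D. X (\<psi> ` t) \<omega>)) = (\<Sum>b\<in>?Pi. G b * prob (?E b))" .
  have "\<bar>(\<Sum>b\<in>?Pi. G b * prob (?E b)) - (\<Sum>b\<in>?Pi. G b * (\<Prod>t\<in>D. marg (b t)))\<bar>
      \<le> (\<Sum>b\<in>?Pi. \<bar>G b * (prob (?E b) - (\<Prod>t\<in>D. marg (b t)))\<bar>)"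
    unfolding sum_subtractf[symmetric] right_diff_distrib[symmetric] by (rule sum_abs)
  also have "\<dots> \<le> (\<Sum>b\<in>?Pi. B * (\<eta> + \<bar>prob {\<omega> \<in> space M. \<forall>t\<in>D. X t \<omega> = b t} - (\<Prod>t\<in>D. marg (b t))\<bar>))"
  proof (rule sum_mono)
    fix b
    have "\<bar>prob (?E b) - (\<Prod>t\<in>D. marg (b t))\<bar> \<le> \<eta> + \<bar>prob {\<omega> \<in> space M. \<forall>t\<in>D. X t \<omega> = b t} - (\<Prod>t\<in>D. marg (b t))\<bar>"
      using spread_event[OF dr(2) r_le_n \<psi> D, of b] by linarith
    then show "\<bar>G b * (prob (?E b) - (\<Prod>t\<in>D. marg (b t)))\<bar>
      \<le> B * (\<eta> + \<bar>prob {\<omega> \<in> space M. \<forall>t\<in>D. X t \<omega> = b t} - (\<Prod>t\<in>D. marg (b t))\<bar>)"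
      unfolding abs_mult using G B by (intro mult_mono) auto
  qed
  also have "\<dots> \<le> B * (real (card \<X>) ^ card D * \<eta> + 2 * (2 * x + 2 * \<eta>) * (real (card \<X>) ^ card D - 1))"
    unfolding sum_distrib_left[symmetric] sum.distrib
    using sum_prob_array_le[OF D] finD B by (intro mult_left_mono add_mono) (auto simp: card_PiE)
  also have "\<dots> \<le> B * ((4 * x + 5 * \<eta>) * real (card \<X>) ^ card D)"
    using B x eta_nonneg dr by (intro mult_left_mono) (auto simp: algebra_simps)
  finally show "\<bar>expectation (\<lambda>\<omega>. G (\<lambda>t\<in>D. X (\<psi> ` t) \<omega>)) - (\<Sum>b\<in>?Pi. G b * (\<Prod>t\<in>D. marg (b t)))\<bar>
      \<le> B * ((4 * x + 5 * \<eta>) * real (card \<X>) ^ card D)"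
    unfolding E .
qed

end

text \<open>The expectation of \<open>H\<close> on an array with independent entries of common law
  \<open>marg\<close>.\<close>

definition iid_mean :: "nat \<Rightarrow> ((nat set \<Rightarrow> 'x) \<Rightarrow> real) \<Rightarrow> real" where
  "iid_mean k H = (\<Sum>b\<in>PiE (dsubsets {1..k} d) (\<lambda>_. \<X>). H b * (\<Prod>t\<in>dsubsets {1..k} d. marg (b t)))"

text \<open>The subarray on the interval from \<open>i * k + 1\<close> to \<open>i * k + k\<close>,
  reindexed by subsets of \<open>{1..k}\<close> so that all intervals share one index set and one
  reference mean.\<close>

definition interval_array :: "nat \<Rightarrow> nat \<Rightarrow> 'a \<Rightarrow> nat set \<Rightarrow> 'x" where
  "interval_array k i \<omega> = (\<lambda>t\<in>dsubsets {1..k} d. X ((+) (i * k) ` t) \<omega>)"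

lemma iid_mean_const:
  assumes "d \<le> n"
  shows "iid_mean k (\<lambda>_. c) = c"
proof -
  have "(\<Sum>b\<in>PiE (dsubsets {1..k} d) (\<lambda>_. \<X>). \<Prod>t\<in>dsubsets {1..k} d. marg (b t)) =
      (\<Prod>t\<in>dsubsets {1..k} d. \<Sum>a\<in>\<X>. marg a)"
    by (rule prod_sum_PiE[symmetric]) (simp_all add: finite_dsubsets finite_X)
  then show ?thesis
    unfolding iid_mean_def by (simp add: sum_marg assms flip: sum_distrib_left)
qed

lemma abs_iid_mean_le:
  assumes "d \<le> n" "\<And>b. \<bar>H b\<bar> \<le> 1"
  shows "\<bar>iid_mean k H\<bar> \<le> 1"
proof -
  have "\<bar>iid_mean k H\<bar> \<le> iid_mean k (\<lambda>_. 1)"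
    unfolding iid_mean_def
    by (intro order_trans[OF sum_abs] sum_mono)
      (auto simp: abs_mult abs_prod marg_nonneg intro!: mult_left_le_one_le prod_nonneg assms)
  then show ?thesis by (simp add: iid_mean_const assms)
qed

text \<open>Both subarrays sit in one array on \<open>2 * k\<close> vertices. Under the product law
  they are independent and each centred factor has mean zero, so only the approximation error is
  left, scaled by the bound \<open>4 = 2 * 2\<close> on the product.\<close>

lemma interval_covariance:
  fixes H1 H2 :: "(nat set \<Rightarrow> 'x) \<Rightarrow> real"
  assumes S: "S \<subseteq> \<X>" "card S = card \<X> - 1" "card \<X> \<ge> 1"
    and R: "R > 0" "R * (2 * k) \<le> n" and k: "d \<le> k"
    and box: "\<And>a. a \<in> S \<Longrightarrow> \<bar>prob {\<omega> \<in> space M. \<forall>s\<in>Box n d. X s \<omega> = a}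
      - (\<Prod>s\<in>Box n d. prob {\<omega> \<in> space M. X s \<omega> = a})\<bar> \<le> \<eta>"
    and x: "0 \<le> x" "(2 + 2 * 2 ^ d) * \<eta> + real d / real R \<le> x ^ 2 ^ d"
    and ij: "i < j" "(j + 1) * k \<le> n" and H: "\<And>b. \<bar>H1 b\<bar> \<le> 1" "\<And>b. \<bar>H2 b\<bar> \<le> 1"
  shows "integrable M (\<lambda>\<omega>. (H1 (interval_array k i \<omega>) - iid_mean k H1) * (H2 (interval_array k j \<omega>) - iid_mean k H2))"
    and "expectation (\<lambda>\<omega>. (H1 (interval_array k i \<omega>) - iid_mean k H1) * (H2 (interval_array k j \<omega>) - iid_mean k H2))
      \<le> 4 * ((4 * x + 5 * \<eta>) * real (card \<X>) ^ (2 * (k choose d)))"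
proof -
  define D where "D = dsubsets {1..k} d"
  define \<sigma> where "\<sigma> t = (+) k ` t" for t :: "nat set"
  \<comment> \<open>Sends the two halves of \<open>{1..2 * k}\<close> to the intervals of
    \<open>i\<close> and \<open>j\<close>, increasingly because \<open>i < j\<close>.\<close>
  define \<psi> where "\<psi> v = (if v \<le> k then i * k + v else j * k + (v - k))" for v
  define c where "c H = iid_mean k H" for H
  define G where "G b = (H1 (restrict b D) - c H1) * (H2 (\<lambda>t\<in>D. b (\<sigma> t)) - c H2)" for b
  have "1 * (2 * k) \<le> R * (2 * k)" using R by (intro mult_le_mono1) auto
  then have kn: "2 * k \<le> n" using R by linarith
  then have dn: "d \<le> n" "2 * d \<le> n" "d \<le> 2 * k" using k by auto
  have finD: "finite D" by (simp add: D_def finite_dsubsets)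
  have inj: "inj_on \<sigma> D" unfolding \<sigma>_def by (rule inj_onI) (simp add: inj_image_eq_iff)
  have Dne: "t \<noteq> {}" "t \<subseteq> {1..k}" if "t \<in> D" for t using that d_pos by (auto simp: D_def dsubsets_def)
  \<comment> \<open>Nonempty sets leave \<open>{1..k}\<close> when shifted by \<open>k\<close>;
    \<open>d \<ge> 1\<close> rules out the empty set.\<close>
  have disj: "D \<inter> \<sigma> ` D = {}"
  proof safe
    fix t assume t: "t \<in> D" "\<sigma> t \<in> D"
    then obtain v where "v \<in> t" using Dne by blast
    then have "k + v \<in> \<sigma> t" "v \<ge> 1" using Dne[OF t(1)] by (auto simp: \<sigma>_def)
    then show "\<sigma> t \<in> {}" using Dne[OF t(2)] by auto
  qed
  have sub: "D \<union> \<sigma> ` D \<subseteq> dsubsets {1..2 * k} d"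
    by (auto simp: D_def \<sigma>_def dsubsets_def card_image)
  have card: "card (D \<union> \<sigma> ` D) = 2 * (k choose d)"
    using finD inj disj by (simp add: card_Un_disjoint card_image D_def card_dsubsets)
  have le: "(i + 1) * k \<le> j * k" using ij by (intro mult_le_mono1) auto
  have mono: "strict_mono_on {1..2 * k} \<psi>"
    using le by (intro strict_mono_onI) (auto simp: \<psi>_def)
  have img: "\<psi> ` {1..2 * k} \<subseteq> {1..n}"
    using le ij by (auto simp: \<psi>_def)
  have bound: "\<bar>G b\<bar> \<le> 4" for b
  proof -
    have "\<bar>H1 b1 - c H1\<bar> \<le> 2" "\<bar>H2 b1 - c H2\<bar> \<le> 2" for b1
      using H(1)[of b1] H(2)[of b1] abs_iid_mean_le[where H = H1 and k = k, OF dn(1) H(1)] abs_iid_mean_le[where H = H2 and k = k, OF dn(1) H(2)]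
      unfolding c_def by auto
    then have "\<bar>G b\<bar> \<le> 2 * 2" unfolding G_def abs_mult by (intro mult_mono) auto
    then show ?thesis by simp
  qed
  have \<psi>1: "\<psi> ` t = (+) (i * k) ` t" if "t \<in> D" for t
    using Dne[OF that] by (intro image_cong) (auto simp: \<psi>_def)
  have \<psi>2: "\<psi> ` \<sigma> t = (+) (j * k) ` t" if "t \<in> D" for t
    unfolding \<sigma>_def image_image using Dne[OF that] by (intro image_cong) (auto simp: \<psi>_def)
  have Geq: "G (\<lambda>t\<in>D \<union> \<sigma> ` D. X (\<psi> ` t) \<omega>)
     = (H1 (interval_array k i \<omega>) - iid_mean k H1) * (H2 (interval_array k j \<omega>) - iid_mean k H2)" for \<omega>
  proof -
    have IA: "interval_array k l \<omega> = (\<lambda>t\<in>D. X ((+) (l * k) ` t) \<omega>)" for l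
      by (simp only: interval_array_def D_def)
    have "restrict (\<lambda>t\<in>D \<union> \<sigma> ` D. X (\<psi> ` t) \<omega>) D = interval_array k i \<omega>"
      by (auto simp: IA \<psi>1 fun_eq_iff restrict_def)
    moreover have "(\<lambda>t\<in>D. (\<lambda>t\<in>D \<union> \<sigma> ` D. X (\<psi> ` t) \<omega>) (\<sigma> t)) = interval_array k j \<omega>"
      by (auto simp: IA \<psi>2 fun_eq_iff restrict_def)
    ultimately show ?thesis by (simp add: G_def c_def)
  qed
  have "(\<Sum>b\<in>PiE D (\<lambda>_. \<X>). (H b - c H) * (\<Prod>t\<in>D. marg (b t))) = 0" for H
    using iid_mean_const[OF dn(1), of k "c H"]
    by (simp add: left_diff_distrib sum_subtractf c_def iid_mean_def D_def)
  then have zero: "(\<Sum>b\<in>PiE (D \<union> \<sigma> ` D) (\<lambda>_. \<X>). G b * (\<Prod>t\<in>D \<union> \<sigma> ` D. marg (b t))) = 0"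
    unfolding G_def
    by (simp add: sum_PiE_two_copies[OF finD inj disj, of "\<lambda>b. H1 b - c H1" "\<lambda>b. H2 b - c H2"])
  note near = expectation_array_near_product[OF S R dn(2,3) box x sub mono img, of G 4, OF _ bound]
  show "integrable M (\<lambda>\<omega>. (H1 (interval_array k i \<omega>) - iid_mean k H1) * (H2 (interval_array k j \<omega>) - iid_mean k H2))"
    using near(1) by (simp only: Geq)
  show "expectation (\<lambda>\<omega>. (H1 (interval_array k i \<omega>) - iid_mean k H1) * (H2 (interval_array k j \<omega>) - iid_mean k H2))
      \<le> 4 * ((4 * x + 5 * \<eta>) * real (card \<X>) ^ (2 * (k choose d)))"
    using near(2) unfolding zero Geq card by linarith
qed

end

section \<open>Numerical estimates and truncation\<close>

lemma two_pow_le_fact: "(2::nat) ^ d \<le> 2 * fact d"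
proof (induction d)
  case (Suc d)
  show ?case
  proof (cases d)
    case (Suc e)
    have "2 * 2 ^ d \<le> Suc d * (2 * fact d)"
      using Suc by (intro mult_le_mono Suc.IH) auto
    then show ?thesis by (simp add: algebra_simps)
  qed simp
qed simp

text \<open>The factorial in the binomial coefficient absorbs the exponent \<open>2 ^ d\<close> of
  the box average, so that \<open>k ^ d\<close> suffices in \<open>C\<close>.\<close>

lemma two_pow_binomial_le: "(2::nat) ^ d * (k choose d) \<le> 2 * k ^ d"
proof -
  have "2 ^ d * (k choose d) \<le> 2 * (fact d * (k choose d))"
    using mult_le_mono1[OF two_pow_le_fact[of d], of "k choose d"] by simp
  also have "fact d * (k choose d) \<le> k ^ d"
    using binomial_fact_pow[of k d] by (simp add: mult.commute)
  finally show ?thesis by simp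
qed

text \<open>With \<open>t = d * k ^ d\<close> the left side is at most
  \<open>10 * t \<le> 1 + 15 * t \<le> 16 ^ t\<close> by Bernoulli. This uses 4 of the 24 in the
  exponent of \<open>C\<close>.\<close>

lemma linear_factor_le_powr:
  fixes Q :: real and d k :: nat
  assumes "1 \<le> d" "d \<le> k" "real (k ^ d) \<le> Q"
  shows "2 + 2 * 2 ^ d + 4 * real k * real d \<le> 2 powr (4 * real d * Q)"
proof -
  define Y where "Y = k ^ d"
  have Y1: "1 \<le> Y" using assms by (simp add: Y_def)
  have kY: "k \<le> Y" using self_le_power[of k d] assms by (simp add: Y_def)
  have "2 ^ d * 1 \<le> 2 ^ d * (k choose d)" using assms by (intro mult_le_mono2) (simp add: Suc_leI)
  then have qY: "2 ^ d \<le> 2 * Y" using two_pow_binomial_le[of d k] unfolding Y_def by linarith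
  have "2 + 2 * 2 ^ d + 4 * k * d \<le> 2 * (d * Y) + 2 * (2 * (d * Y)) + 4 * (d * Y)"
  proof (intro add_mono)
    have "1 * 1 \<le> d * Y" by (rule mult_le_mono) (use assms Y1 in auto)
    then show "2 \<le> 2 * (d * Y)" by simp
    have "1 * Y \<le> d * Y" using assms by (intro mult_le_mono1) auto
    with qY show "2 * 2 ^ d \<le> 2 * (2 * (d * Y))" by linarith
    show "4 * k * d \<le> 4 * (d * Y)" using mult_le_mono2[OF kY, of "4 * d"] by (simp add: mult_ac)
  qed
  also have "\<dots> = 10 * (d * Y)" by simp
  finally have "real (2 + 2 * 2 ^ d + 4 * k * d) \<le> real (10 * (d * Y))"
    by (simp only: of_nat_le_iff)
  also have "\<dots> \<le> 1 + real (d * Y) * 15" by simp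
  also have "\<dots> \<le> (1 + 15) ^ (d * Y)" by (rule Bernoulli_inequality) simp
  also have "\<dots> = (2 ^ 4) ^ (d * Y)" by simp
  also have "\<dots> = 2 powr (4 * real d * real Y)"
    unfolding power_mult[symmetric] by (subst powr_realpow[symmetric]) (auto simp: mult.assoc)
  also have "\<dots> \<le> 2 powr (4 * real d * Q)"
    using assms by (intro powr_mono mult_left_mono) (auto simp: Y_def)
  finally show ?thesis by simp
qed

lemma threshold_bound:
  fixes L C :: real and d k m :: nat
  assumes d: "1 \<le> d" "d \<le> k" and m: "2 \<le> m" and L: "1 \<le> L"
    and C: "C = real m powr (24 * real d * (real k * L) ^ d)"
  shows "(2 + 2 * 2 ^ d + 4 * real k * real d) * (64 * real m powr (2 * real (k choose d) + 2 * L)) ^ 2 ^ d \<le> C"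
proof -
  define Q where "Q = (real k * L) ^ d"
  define q where "q = real (2 ^ d)"
  have mm: "real m \<ge> 2" using m by simp
  have Ld: "1 \<le> L ^ d" "L \<le> L ^ d" using L d by (simp_all add: self_le_power)
  have kQ: "real (k ^ d) \<le> Q"
    using Ld(1) mult_left_mono[of 1 "L ^ d" "real k ^ d"] by (simp add: Q_def power_mult_distrib)
  have kLQ: "real (k ^ d) * L \<le> Q"
    using Ld(2) by (simp add: Q_def power_mult_distrib mult_left_mono)
  have "2 ^ d * 1 \<le> 2 ^ d * (k choose d)" using d by (intro mult_le_mono2) (simp add: Suc_leI)
  then have "2 ^ d \<le> 2 * k ^ d" using two_pow_binomial_le[of d k] by linarith
  then have qk: "q \<le> 2 * real (k ^ d)" unfolding q_def by (metis of_nat_le_iff of_nat_mult of_nat_numeral)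
  have "real (2 ^ d * (k choose d)) \<le> real (2 * k ^ d)"
    using two_pow_binomial_le[of d k] by (simp only: of_nat_le_iff)
  then have qb: "q * real (k choose d) \<le> 2 * real (k ^ d)" unfolding q_def by simp
  have q0: "q \<ge> 0" by (simp add: q_def)
  have "q * 6 \<le> q * L * 6" using L q0 mult_left_mono[of 1 L q] by simp
  moreover have "q * L \<le> 2 * Q" using mult_right_mono[OF qk, of L] L kLQ by linarith
  moreover have "q * real (k choose d) \<le> 2 * Q" using qb kQ by simp
  \<comment> \<open>The other 20 of the 24: at most \<open>12 * Q\<close> from
    \<open>64 = 2 ^ 6\<close>, \<open>4 * Q\<close> from the binomial and \<open>4 * Q\<close> from
    \<open>L\<close>.\<close>
  ultimately have e: "6 * q + q * (2 * real (k choose d) + 2 * L) \<le> 20 * Q"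
    by (simp add: algebra_simps)
  have dQ: "20 * Q \<le> 20 * real d * Q"
    using d mult_right_mono[of 1 "real d" Q] order_trans[OF of_nat_0_le_iff kQ] by simp
  have "(64 * real m powr (2 * real (k choose d) + 2 * L)) ^ 2 ^ d
     = 64 ^ 2 ^ d * real m powr (q * (2 * real (k choose d) + 2 * L))"
  proof -
    have "(real m powr (2 * real (k choose d) + 2 * L)) ^ 2 ^ d = (real m powr (2 * real (k choose d) + 2 * L)) powr q"
      using mm unfolding q_def by (intro powr_realpow[symmetric]) auto
    then show ?thesis by (simp add: power_mult_distrib powr_powr mult.commute[of q])
  qed
  also have "(64::real) ^ 2 ^ d = 2 powr (6 * q)"
  proof -
    have "(2::real) powr (6 * q) = 2 powr real (6 * 2 ^ d)" by (simp add: q_def)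
    also have "\<dots> = 2 ^ (6 * 2 ^ d)" by (rule powr_realpow) simp
    also have "\<dots> = 64 ^ 2 ^ d" by (simp add: power_mult)
    finally show ?thesis by simp
  qed
  also have "2 powr (6 * q) * real m powr (q * (2 * real (k choose d) + 2 * L))
      \<le> real m powr (6 * q) * real m powr (q * (2 * real (k choose d) + 2 * L))"
    using mm q0 by (intro mult_right_mono powr_mono2) auto
  also have "\<dots> = real m powr (6 * q + q * (2 * real (k choose d) + 2 * L))"
    by (simp add: powr_add)
  also have "\<dots> \<le> real m powr (20 * real d * Q)"
    using e dQ mm by (intro powr_mono) auto
  finally have A: "(64 * real m powr (2 * real (k choose d) + 2 * L)) ^ 2 ^ d \<le> real m powr (20 * real d * Q)" .
  have "2 + 2 * 2 ^ d + 4 * real k * real d \<le> 2 powr (4 * real d * Q)"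
    by (rule linear_factor_le_powr[OF d kQ])
  also have "\<dots> \<le> real m powr (4 * real d * Q)"
    using mm kQ by (intro powr_mono2) (auto intro!: mult_nonneg_nonneg order_trans[OF _ kQ])
  finally have "(2 + 2 * 2 ^ d + 4 * real k * real d) * (64 * real m powr (2 * real (k choose d) + 2 * L)) ^ 2 ^ d
      \<le> real m powr (4 * real d * Q) * real m powr (20 * real d * Q)"
    using A by (intro mult_mono) auto
  also have "\<dots> = C"
    by (simp add: C Q_def mult.assoc flip: powr_add)
  finally show ?thesis .
qed

text \<open>The right side is the second moment, relative to \<open>N\<^sup>2\<close>, that the
  truncation tolerates. With \<open>y = 1 / \<epsilon>\<^sup>2\<close> and
  \<open>r = 1 / (p - 1)\<close> its inverse is \<open>y * (4 * y) powr r\<close>, at most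
  \<open>(4 * y\<^sup>2) powr r\<close> since \<open>r \<ge> 1\<close>; then
  \<open>4 * y\<^sup>2 \<le> 4 powr y\<^sup>2\<close>. The square of \<open>y\<close> is the origin
  of \<epsilon> to the fourth power in \<open>L\<close>.\<close>

lemma gap_ge_powr:
  fixes \<epsilon> p :: real and m :: nat
  assumes eps: "0 < \<epsilon>" "\<epsilon> \<le> 1" and p: "1 < p" "p \<le> 2" and m: "2 \<le> m"
  shows "real m powr (- (2 * (1 / (\<epsilon> ^ 4 * (p - 1))))) \<le> \<epsilon>\<^sup>2 * (\<epsilon>\<^sup>2 / 4) powr (1 / (p - 1))"
proof -
  define r where "r = 1 / (p - 1)"
  define y where "y = 1 / \<epsilon>\<^sup>2"
  have r: "1 \<le> r" using p by (simp add: r_def)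
  have y: "1 \<le> y" using eps by (simp add: y_def power_le_one)
  have L: "1 / (\<epsilon> ^ 4 * (p - 1)) = y\<^sup>2 * r"
    by (simp add: y_def r_def power_divide flip: power_mult)
  have y2: "1 \<le> y\<^sup>2" using y by (simp add: one_le_power)
  have "ln (y\<^sup>2) \<le> y\<^sup>2 - 1" using y by (intro ln_le_minus_one) auto
  also have "\<dots> \<le> (y\<^sup>2 - 1) * ln 4"
  proof -
    have "1 \<le> ln (4::real)"
      using exp_le by (subst ln_ge_iff) auto
    then show ?thesis using y2 mult_left_mono[of 1 "ln 4" "y\<^sup>2 - 1"] by simp
  qed
  finally have "ln (4 * y\<^sup>2) \<le> y\<^sup>2 * ln 4" using y by (simp add: ln_mult algebra_simps)
  then have "4 * y\<^sup>2 \<le> 4 powr (y\<^sup>2)"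
    using y by (simp add: powr_def ln_le_cancel_iff[symmetric] del: ln_le_cancel_iff)
  then have "(4 * y\<^sup>2) powr r \<le> (4 powr (y\<^sup>2)) powr r"
    using r y by (intro powr_mono2) auto
  also have "\<dots> = 2 powr (2 * (y\<^sup>2 * r))"
    using powr_powr[of 2 2 "y\<^sup>2 * r"] by (simp add: powr_powr)
  also have "\<dots> \<le> real m powr (2 * (y\<^sup>2 * r))"
    using m r by (intro powr_mono2) auto
  finally have up: "(4 * y\<^sup>2) powr r \<le> real m powr (2 * (y\<^sup>2 * r))" .
  have "y * (4 * y) powr r \<le> y powr r * (4 * y) powr r"
    using powr_mono[of 1 r y] r y by (intro mult_right_mono) auto
  also have "\<dots> = (4 * y\<^sup>2) powr r"
    using y by (simp add: power2_eq_square mult_ac flip: powr_mult)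
  finally have "y * (4 * y) powr r \<le> real m powr (2 * (y\<^sup>2 * r))" using up by simp
  then have "1 / real m powr (2 * (y\<^sup>2 * r)) \<le> 1 / (y * (4 * y) powr r)"
    using y m by (intro divide_left_mono) (auto intro!: mult_pos_pos)
  also have "\<dots> = \<epsilon>\<^sup>2 * (\<epsilon>\<^sup>2 / 4) powr r"
    using eps by (simp add: y_def powr_divide)
  finally show ?thesis unfolding L r_def[symmetric] powr_minus_divide .
qed

text \<open>Truncation done pointwise: below height \<open>\<tau>\<close>, weighted Young and
  \<open>y\<^sup>2 \<le> \<tau> powr (2 - p) * \<bar>y\<bar> powr p\<close>; above it,
  \<open>\<bar>s\<bar> \<le> K\<close> and \<open>\<bar>y\<bar> \<le> \<tau> powr (1 - p) *
  \<bar>y\<bar> powr p\<close>.\<close>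

lemma mult_le_young:
  fixes y s K \<tau> p \<mu> :: real
  assumes p: "1 < p" "p \<le> 2" and \<tau>: "0 < \<tau>" and \<mu>: "0 < \<mu>" and s: "\<bar>s\<bar> \<le> K"
  shows "y * s \<le> (K * \<tau> powr (1 - p) + \<mu> * \<tau> powr (2 - p) / 2) * \<bar>y\<bar> powr p + s\<^sup>2 / (2 * \<mu>)"
proof (cases "\<bar>y\<bar> \<le> \<tau>")
  case True
  have y2: "y\<^sup>2 = \<bar>y\<bar> powr p * \<bar>y\<bar> powr (2 - p)"
    by (cases "y = 0") (simp_all flip: powr_add)
  have "0 \<le> (\<mu> * y - s)\<^sup>2" by simp
  then have "2 * \<mu> * (y * s) \<le> \<mu> * \<mu> * y\<^sup>2 + s\<^sup>2" by (simp add: power2_eq_square algebra_simps)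
  then have "y * s \<le> (\<mu> * \<mu> * y\<^sup>2 + s\<^sup>2) / (2 * \<mu>)" using \<mu> by (simp add: field_simps)
  also have "\<dots> = \<mu> / 2 * y\<^sup>2 + s\<^sup>2 / (2 * \<mu>)" using \<mu> by (simp add: field_simps)
  also have "y\<^sup>2 \<le> \<tau> powr (2 - p) * \<bar>y\<bar> powr p"
    unfolding y2 using True p by (simp add: mult_left_mono powr_mono2 mult.commute)
  then have "\<mu> / 2 * y\<^sup>2 \<le> \<mu> / 2 * (\<tau> powr (2 - p) * \<bar>y\<bar> powr p)" using \<mu> by simp
  moreover have "0 \<le> K * \<tau> powr (1 - p) * \<bar>y\<bar> powr p" using s by simp
  ultimately show ?thesis by (simp add: algebra_simps)
next
  case False
  then have y: "\<bar>y\<bar> > \<tau>" "\<bar>y\<bar> > 0" using \<tau> by auto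
  have "\<bar>y\<bar> = \<bar>y\<bar> powr p * \<bar>y\<bar> powr (1 - p)"
    using y by (simp flip: powr_add)
  also have "\<dots> \<le> \<bar>y\<bar> powr p * \<tau> powr (1 - p)"
    using y \<tau> p by (intro mult_left_mono powr_mono2') auto
  finally have "\<bar>y\<bar> * K \<le> \<bar>y\<bar> powr p * \<tau> powr (1 - p) * K"
    using s by (intro mult_right_mono) auto
  moreover have "y * s \<le> \<bar>y\<bar> * K"
    using abs_ge_self[of "y * s"] mult_left_mono[OF s, of "\<bar>y\<bar>"] by (simp add: abs_mult)
  moreover have "0 \<le> \<mu> * \<tau> powr (2 - p) / 2 * \<bar>y\<bar> powr p" "0 \<le> s\<^sup>2 / (2 * \<mu>)"
    using \<mu> by auto
  ultimately show ?thesis by (simp add: algebra_simps)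
qed

lemma (in prob_space) expectation_mult_le_truncated:
  fixes F S :: "'a \<Rightarrow> real"
  assumes p: "1 < p" "p \<le> 2" and \<epsilon>: "0 < \<epsilon>" and N: "0 < N"
    and int: "integrable M (\<lambda>\<omega>. F \<omega> * S \<omega>)" "integrable M (\<lambda>\<omega>. \<bar>F \<omega>\<bar> powr p)" "integrable M (\<lambda>\<omega>. (S \<omega>)\<^sup>2)"
    and F: "expectation (\<lambda>\<omega>. \<bar>F \<omega>\<bar> powr p) = 1"
    and S: "\<And>\<omega>. \<omega> \<in> space M \<Longrightarrow> \<bar>S \<omega>\<bar> \<le> 2 * N"
    and V: "expectation (\<lambda>\<omega>. (S \<omega>)\<^sup>2) \<le> N\<^sup>2 * (\<epsilon>\<^sup>2 * (\<epsilon>\<^sup>2 / 4) powr (1 / (p - 1)))"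
  shows "expectation (\<lambda>\<omega>. F \<omega> * S \<omega>) \<le> N * \<epsilon>\<^sup>2"
proof -
  define r where "r = 1 / (p - 1)"
  \<comment> \<open>Chosen so that \<open>\<tau> powr (1 - p) = \<epsilon>\<^sup>2 / 4\<close>: the
    part above \<open>\<tau>\<close> contributes \<open>N * \<epsilon>\<^sup>2 / 2\<close>.\<close>
  define \<tau> where "\<tau> = (4 / \<epsilon>\<^sup>2) powr r"
  \<comment> \<open>Balances the two Young terms at \<open>N * \<epsilon>\<^sup>2 / 4\<close>
    each.\<close>
  define \<mu> where "\<mu> = N * \<epsilon>\<^sup>2 / 2 / \<tau> powr (2 - p)"
  have pos: "0 < \<tau>" "0 < \<mu>" using \<epsilon> N by (auto simp: \<tau>_def \<mu>_def)
  have rp: "r * (1 - p) = -1" using p by (simp add: r_def field_simps)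
  have t1: "\<tau> powr (1 - p) = \<epsilon>\<^sup>2 / 4"
    using \<epsilon> by (simp add: \<tau>_def powr_powr rp powr_minus_divide)
  have t2: "\<tau> powr (2 - p) = \<tau> * (\<epsilon>\<^sup>2 / 4)"
    using pos powr_add[of \<tau> 1 "1 - p"] t1 by simp
  have t3: "(\<epsilon>\<^sup>2 / 4) powr r = 1 / \<tau>"
    using \<epsilon> by (simp add: \<tau>_def powr_divide)
  have "expectation (\<lambda>\<omega>. F \<omega> * S \<omega>) \<le> expectation (\<lambda>\<omega>. (2 * N * \<tau> powr (1 - p) + \<mu> * \<tau> powr (2 - p) / 2) * \<bar>F \<omega>\<bar> powr p + (S \<omega>)\<^sup>2 / (2 * \<mu>))"
    using int pos by (intro integral_mono mult_le_young p S) auto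
  also have "\<dots> = (2 * N * \<tau> powr (1 - p) + \<mu> * \<tau> powr (2 - p) / 2) + expectation (\<lambda>\<omega>. (S \<omega>)\<^sup>2) / (2 * \<mu>)"
    using int by (simp add: F)
  also have "\<dots> \<le> (2 * N * \<tau> powr (1 - p) + \<mu> * \<tau> powr (2 - p) / 2) + N\<^sup>2 * (\<epsilon>\<^sup>2 * (1 / \<tau>)) / (2 * \<mu>)"
    using V pos unfolding r_def[symmetric] t3 by (intro add_left_mono divide_right_mono) auto
  also have "2 * N * \<tau> powr (1 - p) = N * \<epsilon>\<^sup>2 / 2" by (simp add: t1)
  also have "\<mu> * \<tau> powr (2 - p) / 2 = N * \<epsilon>\<^sup>2 / 4" using pos by (simp add: \<mu>_def)
  also have "N\<^sup>2 * (\<epsilon>\<^sup>2 * (1 / \<tau>)) / (2 * \<mu>) = N * \<epsilon>\<^sup>2 / 4"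
    unfolding \<mu>_def t2 using pos N \<epsilon> by (simp add: field_simps power2_eq_square)
  finally show ?thesis by simp
qed

section \<open>Conditional expectations on intervals\<close>

text \<open>\<open>R\<close> is the block length when \<open>2 * k\<close> vertices are blown up,
  and \<open>N\<close> the number of disjoint intervals of length \<open>k\<close>. In
  \<open>1 / x = 64 * m powr (T + 2 * L)\<close> the power \<open>T\<close> pays for the number of
  values of two subarrays, \<open>2 * L\<close> for the gap, and 64 for constants: the covariance
  error uses \<open>5 / 16\<close> of the gap and \<open>4 / N\<close> uses
  \<open>1 / 32\<close>.\<close>

lemma parameter_bounds:
  fixes L C :: real and d k m n :: nat
  assumes d: "1 \<le> d" "d \<le> k" and m: "2 \<le> m" and L: "1 \<le> L"
    and C: "C = real m powr (24 * real d * (real k * L) ^ d)" and n: "C \<le> real n"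
  obtains x R N where "0 < R" "R * (2 * k) \<le> n" "0 < N" "N * k \<le> n" "0 \<le> x"
    "(2 + 2 * 2 ^ d) * (1 / C) + real d / real R \<le> x ^ 2 ^ d"
    "4 / real N + 4 * ((4 * x + 5 * (1 / C)) * real m ^ (2 * (k choose d))) \<le> real m powr (- (2 * L))"
proof -
  define T where "T = 2 * real (k choose d)"
  define y where "y = 64 * real m powr (T + 2 * L)"
  define x where "x = 1 / y"
  define R where "R = n div (2 * k)"
  define N where "N = n div k"
  define w where "w = real m powr (2 * L)"
  have k: "1 \<le> k" using d by simp
  have mm: "1 \<le> real m" "2 \<le> real m" using m by auto
  have w1: "1 \<le> w" using mm L by (simp add: w_def ge_one_powr_ge_zero)
  have mT: "real m ^ (2 * (k choose d)) = real m powr T"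
    using mm by (simp add: T_def flip: powr_realpow)
  have mT1: "1 \<le> real m powr T" using mm by (simp add: T_def ge_one_powr_ge_zero)
  have y: "y = 64 * (real m powr T * w)" by (simp add: y_def w_def powr_add)
  have "1 * w \<le> real m powr T * w" using mT1 w1 by (intro mult_right_mono) auto
  then have yw: "64 * w \<le> y" unfolding y by simp
  then have y1: "1 \<le> y" using w1 by linarith
  have yq: "y \<le> y ^ 2 ^ d" using y1 by (intro self_le_power) auto
  have key: "(2 + 2 * 2 ^ d + 4 * real k * real d) * y ^ 2 ^ d \<le> C"
    unfolding y_def T_def by (rule threshold_bound[OF d m L C])
  have C0: "0 < C" unfolding C using mm by simp
  have kd: "real k * 1 \<le> real k * real d" using d by (intro mult_left_mono) auto
  have "4 * real k \<le> 2 + 2 * 2 ^ d + 4 * real k * real d"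
    using kd zero_le_power[of "2::real" d] by linarith
  then have "4 * real k * (64 * w) \<le> (2 + 2 * 2 ^ d + 4 * real k * real d) * y ^ 2 ^ d"
    using yq yw kd w1 by (intro mult_mono) (auto intro: add_nonneg_nonneg)
  then have Cw: "256 * real k * w \<le> C" using key by simp
  have "256 * real k * 1 \<le> 256 * real k * w" using w1 by (intro mult_left_mono) auto
  then have Ck: "256 * real k \<le> C" using Cw by simp
  \<comment> \<open>Rounding down costs at most 1, hence at most half of
    \<open>C / l \<ge> 2\<close>.\<close>
  have floor: "C / (2 * real l) \<le> real (n div l)" if l: "1 \<le> l" "2 * real l \<le> C" for l
  proof -
    have "n < (n div l + 1) * l" using l dividend_less_div_times[of l n] by (simp add: algebra_simps)
    then have "real n < (real (n div l) + 1) * real l" by (metis of_nat_1 of_nat_add of_nat_less_iff of_nat_mult)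
    then have "C < (real (n div l) + 1) * real l" using n by linarith
    then have "C / real l < real (n div l) + 1" using l by (simp add: pos_divide_less_eq)
    moreover have "1 \<le> C / (2 * real l)" using l by simp
    moreover have "C / real l = C / (2 * real l) + C / (2 * real l)" using l by (simp add: field_simps)
    ultimately show ?thesis by linarith
  qed
  have Rge: "C / (4 * real k) \<le> real R"
    using floor[of "2 * k"] k Ck by (simp add: R_def)
  have Nge: "C / (2 * real k) \<le> real N"
    using floor[of k] k Ck by (simp add: N_def)
  have pos: "0 < C / (4 * real k)" "0 < C / (2 * real k)" using C0 k by auto
  have xq: "x ^ 2 ^ d = 1 / y ^ 2 ^ d" by (simp add: x_def power_divide)
  have "(2 + 2 * 2 ^ d + 4 * real k * real d) / C \<le> x ^ 2 ^ d"
    unfolding xq using key C0 y1 by (simp add: field_simps)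
  moreover have "real d / real R \<le> real d / (C / (4 * real k))"
    using Rge pos by (intro frac_le) auto
  then have "real d / real R \<le> 4 * real k * real d / C" by (simp add: field_simps)
  ultimately have xb: "(2 + 2 * 2 ^ d) * (1 / C) + real d / real R \<le> x ^ 2 ^ d"
    by (simp add: add_divide_distrib)
  have x0: "0 \<le> x" "x \<le> 1" using y1 by (auto simp: x_def)
  have "x ^ 2 ^ d \<le> x" using power_decreasing[of 1 "2 ^ d" x] x0 by simp
  moreover have "5 * (1 / C) \<le> (2 + 2 * 2 ^ d) * (1 / C)"
    using C0 power_increasing[OF d(1), of "2::real"] by (intro mult_right_mono) auto
  moreover have "0 \<le> real d / real R" by simp
  ultimately have "5 * (1 / C) \<le> x" using xb by linarith
  then have "4 * ((4 * x + 5 * (1 / C)) * real m ^ (2 * (k choose d))) \<le> 4 * ((5 * x) * real m powr T)"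
    unfolding mT by (intro mult_left_mono mult_right_mono) auto
  also have "\<dots> = 5 / 16 * (1 / w)"
    using mT1 w1 m by (simp add: x_def y field_simps)
  finally have B1: "4 * ((4 * x + 5 * (1 / C)) * real m ^ (2 * (k choose d))) \<le> 5 / 16 * (1 / w)" .
  have "4 / real N \<le> 4 / (C / (2 * real k))"
    using Nge pos by (intro frac_le) auto
  also have "\<dots> = 8 * real k / C" by simp
  also have "\<dots> \<le> 1 / 32 * (1 / w)" using Cw C0 w1 k by (simp add: field_simps)
  finally have B2: "4 / real N \<le> 1 / 32 * (1 / w)" .
  have "0 < 1 / w" using w1 by simp
  with B1 B2 have B: "4 / real N + 4 * ((4 * x + 5 * (1 / C)) * real m ^ (2 * (k choose d))) \<le> 1 / w"
    by linarith
  have "0 < R" "0 < N" using Rge Nge pos by auto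
  moreover have "R * (2 * k) \<le> n" "N * k \<le> n" by (simp_all add: R_def N_def)
  ultimately show thesis
    using that[of R N x] x0 xb B unfolding w_def powr_minus_divide by blast
qed

section \<open>Large conditional expectations give bounded test functions\<close>

context spreadable_array
begin

lemma subalgebra_gen_alg:
  assumes "J \<subseteq> {1..n}"
  shows "subalgebra M (gen_alg M X d J)"
proof -
  let ?G = "\<Union>s\<in>dsubsets J d. {X s -` A \<inter> space M | A. A \<in> sets (count_space UNIV)}"
  have "?G \<subseteq> events"
    using assms measurable_sets[OF X_meas] by (fastforce simp: dsubsets_def)
  then have "sigma_sets (space M) ?G \<subseteq> events" by (rule sets.sigma_sets_subset)
  moreover have "?G \<subseteq> Pow (space M)" by auto
  ultimately show ?thesis
    by (simp add: subalgebra_def gen_alg_def sets_measure_of space_measure_of)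
qed

text \<open>Generating events depend only on the entries over \<open>J\<close>, a property kept by
  complements and countable unions. It stands in for a factorisation theorem when \<open>h\<close>
  is written as a function of the subarray.\<close>

lemma gen_alg_mem_cong:
  assumes "A \<in> sets (gen_alg M X d J)" "\<omega> \<in> space M" "\<omega>' \<in> space M"
    and "\<And>s. s \<in> dsubsets J d \<Longrightarrow> X s \<omega> = X s \<omega>'"
  shows "\<omega> \<in> A \<longleftrightarrow> \<omega>' \<in> A"
proof -
  let ?G = "\<Union>s\<in>dsubsets J d. {X s -` A \<inter> space M | A. A \<in> sets (count_space UNIV)}"
  have "?G \<subseteq> Pow (space M)" by auto
  then have "A \<in> sigma_sets (space M) ?G"
    using assms(1) by (simp add: gen_alg_def sets_measure_of)
  then show ?thesis
    by induction (use assms(2-4) in auto)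
qed

text \<open>An arbitrary \<open>f\<close> is composed with an array that takes finitely many
  values.\<close>

lemma array_function_measurable:
  fixes f :: "(nat set \<Rightarrow> 'x) \<Rightarrow> real"
  shows "(\<lambda>\<omega>. f (\<lambda>s\<in>dsubsets {1..n} d. X s \<omega>)) \<in> borel_measurable M"
    and "\<exists>B. \<forall>\<omega>\<in>space M. \<bar>f (\<lambda>s\<in>dsubsets {1..n} d. X s \<omega>)\<bar> \<le> B"
proof -
  let ?D = "dsubsets {1..n} d"
  let ?Pi = "PiE ?D (\<lambda>_. \<X>)"
  let ?Y = "\<lambda>\<omega>. \<lambda>s\<in>?D. X s \<omega>"
  have finD: "finite ?D" by (simp add: finite_dsubsets)
  have fin: "finite ?Pi" using finite_X finD by (simp add: finite_PiE)
  have Y: "?Y \<omega> \<in> ?Pi" if "\<omega> \<in> space M" for \<omega> using X_val that by auto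
  have "?Y -` {b} \<inter> space M \<in> events" if "b \<in> ?Pi" for b
  proof -
    have "?Y \<omega> = b \<longleftrightarrow> (\<forall>t\<in>?D. X t \<omega> = b t)" if "\<omega> \<in> space M" for \<omega>
      using PiE_ext[OF Y[OF that] \<open>b \<in> ?Pi\<close>] by auto
    then have "?Y -` {b} \<inter> space M = {\<omega> \<in> space M. \<forall>t\<in>?D. X t \<omega> = b t}"
      by auto
    then show ?thesis using sets_X_all_eq[OF finD, of "\<lambda>t. t" b] by simp
  qed
  then have "?Y \<in> measurable M (count_space ?Pi)"
    unfolding measurable_count_space_eq2[OF fin] by (intro conjI funcsetI ballI Y)
  then show "(\<lambda>\<omega>. f (?Y \<omega>)) \<in> borel_measurable M"
    by (rule measurable_compose) simp
  show "\<exists>B. \<forall>\<omega>\<in>space M. \<bar>f (?Y \<omega>)\<bar> \<le> B"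
    using fin Y by (intro exI[of _ "Max ((\<lambda>b. \<bar>f b\<bar>) ` ?Pi)"] ballI Max_ge) auto
qed

text \<open>Let \<open>g\<close> be the conditional expectation and \<open>h\<close> its sign where
  \<open>\<bar>g\<bar> > \<epsilon>\<close>, else 0. As \<open>h\<close> is measurable for the
  sub-algebra, \<open>E[F h] = E[g h]\<close>, which is at least \<epsilon> times the probability of
  that set, and this probability exceeds \<epsilon>.\<close>

lemma exists_test_function:
  assumes J: "J \<subseteq> {i * k + 1..<i * k + 1 + k}" and i: "(i + 1) * k \<le> n" and \<epsilon>: "0 < \<epsilon>"
    and F: "F \<in> borel_measurable M" "integrable M F"
    and bad: "prob {\<omega> \<in> space M. \<bar>real_cond_exp M (gen_alg M X d J) F \<omega>\<bar> \<le> \<epsilon>} < 1 - \<epsilon>"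
  shows "\<exists>H. (\<forall>b. \<bar>H b\<bar> \<le> 1) \<and> (\<lambda>\<omega>. H (interval_array k i \<omega>)) \<in> borel_measurable M
    \<and> \<epsilon>\<^sup>2 < expectation (\<lambda>\<omega>. F \<omega> * H (interval_array k i \<omega>))"
proof -
  let ?G = "gen_alg M X d J"
  have Jn: "J \<subseteq> {1..n}" using J i by (auto simp: subset_eq)
  note sub = subalgebra_gen_alg[OF Jn]
  interpret G: finite_measure_subalgebra M ?G
    by unfold_locales (rule sub)
  define g where "g = real_cond_exp M ?G F"
  define h where "h \<omega> = (if \<bar>g \<omega>\<bar> \<le> \<epsilon> then 0 else sgn (g \<omega>))" for \<omega>
  have gG: "g \<in> borel_measurable ?G" by (simp add: g_def)
  have hG: "h \<in> borel_measurable ?G" unfolding h_def[abs_def] using gG by measurable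
  have gM: "g \<in> borel_measurable M" and hM: "h \<in> borel_measurable M"
    using gG hG sub by (auto intro: measurable_from_subalg)
  have h1: "\<bar>h \<omega>\<bar> \<le> 1" for \<omega> by (simp add: h_def abs_sgn_eq)
  have int: "integrable M (\<lambda>\<omega>. h \<omega> * F \<omega>)"
    by (rule Bochner_Integration.integrable_bound[OF F(2)]) (use hM F h1 in \<open>auto simp: abs_mult mult_left_le_one_le\<close>)
  note ce = G.real_cond_exp_intg[OF int hG F(1), folded g_def]
  let ?A = "{\<omega> \<in> space M. \<bar>g \<omega>\<bar> \<le> \<epsilon>}"
  have A: "?A \<in> events" using gM by measurable
  have "\<epsilon> < prob (space M - ?A)"
    using bad unfolding g_def[symmetric] prob_compl[OF A] by simp
  then have "\<epsilon> * \<epsilon> < \<epsilon> * prob (space M - ?A)"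
    using \<epsilon> by (intro mult_strict_left_mono)
  also have "\<dots> = expectation (\<lambda>\<omega>. \<epsilon> * indicator (space M - ?A) \<omega>)"
    using A by simp
  also have "\<dots> \<le> expectation (\<lambda>\<omega>. h \<omega> * g \<omega>)"
  proof (rule integral_mono)
    show "integrable M (\<lambda>\<omega>. \<epsilon> * indicator (space M - ?A) \<omega>)"
      using A by (auto simp: emeasure_eq_measure)
    show "\<epsilon> * indicator (space M - ?A) \<omega> \<le> h \<omega> * g \<omega>" if "\<omega> \<in> space M" for \<omega>
      using that \<epsilon> by (auto simp: h_def indicator_def sgn_if split: if_splits)
  qed (rule ce(1))
  also have "\<dots> = expectation (\<lambda>\<omega>. F \<omega> * h \<omega>)" unfolding ce(2) by (simp add: mult.commute)
  finally have E: "\<epsilon>\<^sup>2 < expectation (\<lambda>\<omega>. F \<omega> * h \<omega>)" by (simp add: power2_eq_square)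
  have hcong: "h \<omega> = h \<omega>'"
    if \<omega>: "\<omega> \<in> space M" "\<omega>' \<in> space M" and eq: "interval_array k i \<omega> = interval_array k i \<omega>'" for \<omega> \<omega>'
  proof -
    have X: "X s \<omega> = X s \<omega>'" if s: "s \<in> dsubsets J d" for s
    proof -
      define t where "t = (\<lambda>v. v - i * k) ` s"
      have sJ: "s \<subseteq> {i * k + 1..i * k + k}" 
      proof
        fix v assume "v \<in> s"
        then have "v \<in> {i * k + 1..<i * k + 1 + k}" using s J by (auto simp: dsubsets_def)
        then show "v \<in> {i * k + 1..i * k + k}" by simp
      qed
      have "inj_on (\<lambda>v. v - i * k) s" using sJ by (auto intro!: inj_onI simp: subset_eq)
      then have "t \<in> dsubsets {1..k} d"
        using s sJ by (auto simp: t_def dsubsets_def card_image subset_eq)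
      moreover have "(+) (i * k) ` t = s"
        using sJ unfolding t_def image_image by (force simp: subset_eq image_iff)
      ultimately show ?thesis
        using fun_cong[OF eq, of t] by (simp add: interval_array_def)
    qed
    \<comment> \<open>A level set of \<open>g\<close> lies in the generated algebra and cannot
      separate two points with equal entries.\<close>
    have "{\<omega>'' \<in> space ?G. g \<omega>'' = g \<omega>} \<in> sets ?G" using gG by measurable
    from gen_alg_mem_cong[OF this \<omega> X] have "g \<omega>' = g \<omega>"
      using \<omega> sub by (auto simp: subalgebra_def)
    then show ?thesis by (simp add: h_def)
  qed
  \<comment> \<open>Any preimage serves, by \<open>hcong\<close>; the value 0 off the range keeps
    \<open>\<bar>H b\<bar> \<le> 1\<close> for every \<open>b\<close>.\<close>
  define H where "H b = (if \<exists>\<omega>\<in>space M. interval_array k i \<omega> = b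
    then h (SOME \<omega>. \<omega> \<in> space M \<and> interval_array k i \<omega> = b) else 0)" for b
  have Hh: "H (interval_array k i \<omega>) = h \<omega>" if \<omega>: "\<omega> \<in> space M" for \<omega>
  proof -
    let ?\<omega> = "SOME \<omega>'. \<omega>' \<in> space M \<and> interval_array k i \<omega>' = interval_array k i \<omega>"
    have some: "?\<omega> \<in> space M \<and> interval_array k i ?\<omega> = interval_array k i \<omega>"
      by (rule someI[of _ \<omega>]) (use \<omega> in auto)
    have "H (interval_array k i \<omega>) = h ?\<omega>"
      unfolding H_def by (rule if_P) (use \<omega> in blast)
    also have "\<dots> = h \<omega>"
      by (rule hcong[OF conjunct1[OF some] \<omega> conjunct2[OF some]])
    finally show ?thesis .
  qed
  have "(\<lambda>\<omega>. H (interval_array k i \<omega>)) \<in> borel_measurable M"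
    using hM by (rule measurable_cong[THEN iffD1, rotated]) (simp add: Hh)
  moreover have "expectation (\<lambda>\<omega>. F \<omega> * h \<omega>) = expectation (\<lambda>\<omega>. F \<omega> * H (interval_array k i \<omega>))"
    by (rule Bochner_Integration.integral_cong) (simp_all add: Hh)
  moreover have "\<bar>H b\<bar> \<le> 1" for b using h1 by (simp add: H_def)
  ultimately show ?thesis using E by auto
qed

end

section \<open>The second moment argument\<close>

theorem theorem6p1:
  fixes d m k n :: nat and p \<epsilon> C :: real
    and \<X> :: "'x set" and M :: "'a measure" and X :: "nat set \<Rightarrow> 'a \<Rightarrow> 'x"
    and f :: "(nat set \<Rightarrow> 'x) \<Rightarrow> real"
  assumes d_pos: "d \<ge> 1" and m_ge: "m \<ge> 2"
    and p: "1 < p" "p \<le> 2"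
    and eps: "0 < \<epsilon>" "\<epsilon> \<le> 1"
    and k: "k \<ge> d"
    and C_def: "C = exp (24 * real d * ln (real m) / (\<epsilon> ^ (4 * d) * (p - 1) ^ d) * real k ^ d)"
    and n: "real n \<ge> C"
    and Xfin: "finite \<X>" and Xcard: "card \<X> = m"
    and prob: "prob_space M"
    and X_meas: "\<And>s. s \<in> dsubsets {1..n} d \<Longrightarrow> X s \<in> measurable M (count_space UNIV)"
    and X_val: "\<And>s \<omega>. s \<in> dsubsets {1..n} d \<Longrightarrow> \<omega> \<in> space M \<Longrightarrow> X s \<omega> \<in> \<X>"
    and spread: "spreadable M X n d (1 / C)"
    and box: "\<exists>S \<subseteq> \<X>. card S = card \<X> - 1 \<and>
       (\<forall>a\<in>S. \<bar>measure M {\<omega> \<in> space M. \<forall>s\<in>Box n d. X s \<omega> = a}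
               - (\<Prod>s\<in>Box n d. measure M {\<omega> \<in> space M. X s \<omega> = a})\<bar> \<le> 1 / C)"
    and mean0: "(\<integral>\<omega>. f (\<lambda>s\<in>dsubsets {1..n} d. X s \<omega>) \<partial>M) = 0"
    and norm1: "(\<integral>\<omega>. \<bar>f (\<lambda>s\<in>dsubsets {1..n} d. X s \<omega>)\<bar> powr p \<partial>M) powr (1 / p) = 1"
  shows "\<exists>a. 1 \<le> a \<and> a + k - 1 \<le> n \<and>
     (\<forall>J. J \<subseteq> {a..<a + k} \<and> card J \<ge> d \<longrightarrow>
        measure M {\<omega> \<in> space M.
           \<bar>real_cond_exp M (gen_alg M X d J) (\<lambda>\<omega>'. f (\<lambda>s\<in>dsubsets {1..n} d. X s \<omega>')) \<omega>\<bar> \<le> \<epsilon>}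
        \<ge> 1 - \<epsilon>)"
proof (rule ccontr)
  assume contra: "\<not> (\<exists>a. 1 \<le> a \<and> a + k - 1 \<le> n \<and>
     (\<forall>J. J \<subseteq> {a..<a + k} \<and> card J \<ge> d \<longrightarrow>
        measure M {\<omega> \<in> space M.
           \<bar>real_cond_exp M (gen_alg M X d J) (\<lambda>\<omega>'. f (\<lambda>s\<in>dsubsets {1..n} d. X s \<omega>')) \<omega>\<bar> \<le> \<epsilon>}
        \<ge> 1 - \<epsilon>))"
  define F where "F \<omega> = f (\<lambda>s\<in>dsubsets {1..n} d. X s \<omega>)" for \<omega>
  define L where "L = 1 / (\<epsilon> ^ 4 * (p - 1))"
  have "\<epsilon> ^ 4 * (p - 1) \<le> 1 * 1"
    using eps p by (intro mult_mono) (auto intro: power_le_one)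
  moreover have "0 < \<epsilon> ^ 4 * (p - 1)" using eps p by simp
  ultimately have L: "1 \<le> L" by (simp add: L_def)
  have "24 * real d * ln (real m) / (\<epsilon> ^ (4 * d) * (p - 1) ^ d) * real k ^ d
      = 24 * real d * (real k * L) ^ d * ln (real m)"
    by (simp add: L_def power_mult power_mult_distrib power_divide)
  then have C: "C = real m powr (24 * real d * (real k * L) ^ d)"
    using m_ge by (simp add: C_def powr_def)
  obtain x R N where R: "0 < R" "R * (2 * k) \<le> n" and N: "0 < N" "N * k \<le> n"
    and x: "0 \<le> x" "(2 + 2 * 2 ^ d) * (1 / C) + real d / real R \<le> x ^ 2 ^ d"
    and xN: "4 / real N + 4 * ((4 * x + 5 * (1 / C)) * real m ^ (2 * (k choose d))) \<le> real m powr (- (2 * L))"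
    by (rule parameter_bounds[OF d_pos k m_ge L C n]) (rule that)
  interpret spreadable_array M X \<X> n d "1 / C"
    by (intro spreadable_array.intro spreadable_array_axioms.intro) (use prob d_pos X_meas X_val Xfin spread in auto)
  obtain S where S: "S \<subseteq> \<X>" "card S = card \<X> - 1" "card \<X> \<ge> 1"
    and boxS: "\<And>a. a \<in> S \<Longrightarrow> \<bar>prob {\<omega> \<in> space M. \<forall>s\<in>Box n d. X s \<omega> = a}
      - (\<Prod>s\<in>Box n d. prob {\<omega> \<in> space M. X s \<omega> = a})\<bar> \<le> 1 / C"
    using box Xcard m_ge by auto
  have dn: "d \<le> n" using N k mult_le_mono1[of 1 N k] by linarith
  obtain B where FB: "\<And>\<omega>. \<omega> \<in> space M \<Longrightarrow> \<bar>F \<omega>\<bar> \<le> B"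
    using array_function_measurable(2)[of f] unfolding F_def by blast
  have FM: "F \<in> borel_measurable M" unfolding F_def[abs_def] by (rule array_function_measurable)
  have Fint: "integrable M F" by (rule integrable_const_bound[of _ B]) (use FM FB in auto)
  have intFp: "integrable M (\<lambda>\<omega>. \<bar>F \<omega>\<bar> powr p)"
    by (rule integrable_const_bound[of _ "B powr p"]) (use FM FB p in \<open>auto intro!: powr_mono2\<close>)
  have Fp: "expectation (\<lambda>\<omega>. \<bar>F \<omega>\<bar> powr p) = 1"
  proof -
    let ?I = "expectation (\<lambda>\<omega>. \<bar>F \<omega>\<bar> powr p)"
    have I: "?I powr (1 / p) = 1" using norm1 by (simp add: F_def)
    have "0 \<le> ?I" by simp
    then have "(?I powr (1 / p)) powr p = ?I" using p by (simp add: powr_powr)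
    then show ?thesis using I by simp
  qed
  have "\<exists>H. (\<forall>b. \<bar>H b\<bar> \<le> 1) \<and> (\<lambda>\<omega>. H (interval_array k i \<omega>)) \<in> borel_measurable M
    \<and> \<epsilon>\<^sup>2 < expectation (\<lambda>\<omega>. F \<omega> * H (interval_array k i \<omega>))" if i: "i < N" for i
  proof -
    have "(i + 1) * k \<le> N * k" using i by (intro mult_le_mono1) auto
    then have ik: "(i + 1) * k \<le> n" using N by linarith
    then have "1 \<le> i * k + 1 \<and> i * k + 1 + k - 1 \<le> n" by auto
    then obtain J where J: "J \<subseteq> {i * k + 1..<i * k + 1 + k}" "d \<le> card J"
      and bad: "prob {\<omega> \<in> space M. \<bar>real_cond_exp M (gen_alg M X d J) F \<omega>\<bar> \<le> \<epsilon>} < 1 - \<epsilon>"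
      using contra unfolding F_def[abs_def] by (meson not_le)
    show ?thesis by (rule exists_test_function[OF J(1) ik eps(1) FM Fint bad])
  qed
  then obtain H where H1: "\<And>i b. i < N \<Longrightarrow> \<bar>H i b\<bar> \<le> 1"
    and HM: "\<And>i. i < N \<Longrightarrow> (\<lambda>\<omega>. H i (interval_array k i \<omega>)) \<in> borel_measurable M"
    and HE: "\<And>i. i < N \<Longrightarrow> \<epsilon>\<^sup>2 < expectation (\<lambda>\<omega>. F \<omega> * H i (interval_array k i \<omega>))"
    by metis
  \<comment> \<open>Centred at the product mean, as the covariance estimate requires; the shift does
    not affect the correlation with \<open>F\<close>, whose expectation is 0.\<close>
  define U where "U i \<omega> = H i (interval_array k i \<omega>) - iid_mean k (H i)" for i \<omega>
  define V where "V \<omega> = (\<Sum>i<N. U i \<omega>)" for \<omega>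
  have c1: "\<bar>iid_mean k (H i)\<bar> \<le> 1" if "i < N" for i
    using dn H1[OF that] by (rule abs_iid_mean_le)
  have U2: "\<bar>U i \<omega>\<bar> \<le> 2" if "i < N" for i \<omega>
    using H1[OF that, of "interval_array k i \<omega>"] c1[OF that] unfolding U_def by linarith
  have UM: "U i \<in> borel_measurable M" if "i < N" for i
    unfolding U_def[abs_def] using HM[OF that] by measurable
  have UU: "\<bar>U i \<omega> * U j \<omega>\<bar> \<le> 4" if "i < N" "j < N" for i j \<omega>
    using mult_mono[OF U2[OF that(1)] U2[OF that(2)]] by (simp add: abs_mult)
  have intUU: "integrable M (\<lambda>\<omega>. U i \<omega> * U j \<omega>)" if "i < N" "j < N" for i j
    by (rule integrable_const_bound[of _ 4]) (use UM UU that in auto)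
  let ?\<theta> = "4 * ((4 * x + 5 * (1 / C)) * real m ^ (2 * (k choose d)))"
  have cov_less: "expectation (\<lambda>\<omega>. U i \<omega> * U j \<omega>) \<le> ?\<theta>" if ij: "i < j" "j < N" for i j
  proof -
    have "(j + 1) * k \<le> N * k" using ij by (intro mult_le_mono1) auto
    then have jk: "(j + 1) * k \<le> n" using N by linarith
    show ?thesis
      unfolding U_def Xcard[symmetric]
      by (rule interval_covariance(2)[OF S R k boxS x ij(1) jk]) (use H1 ij in auto)
  qed
  have cov: "expectation (\<lambda>\<omega>. U i \<omega> * U j \<omega>) \<le> ?\<theta>" if "i \<noteq> j" "i < N" "j < N" for i j
    using cov_less[of i j] cov_less[of j i] that by (cases "i < j") (auto simp: mult.commute)
  have \<theta>: "0 \<le> ?\<theta>" using x eta_nonneg dn by simp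
  have diag: "expectation (\<lambda>\<omega>. U i \<omega> * U i \<omega>) \<le> 4" if "i < N" for i
  proof -
    have "expectation (\<lambda>\<omega>. U i \<omega> * U i \<omega>) \<le> expectation (\<lambda>_. 4)"
      using intUU[OF that that] UU[OF that that] by (intro integral_mono) (auto simp: abs_le_iff)
    then show ?thesis by (simp add: prob_space)
  qed
  have V2: "(V \<omega>)\<^sup>2 = (\<Sum>i<N. \<Sum>j<N. U i \<omega> * U j \<omega>)" for \<omega>
    by (simp add: V_def power2_eq_square sum_product)
  have intV2: "integrable M (\<lambda>\<omega>. (V \<omega>)\<^sup>2)"
    unfolding V2 using intUU by (intro Bochner_Integration.integrable_sum) auto
  have "expectation (\<lambda>\<omega>. (V \<omega>)\<^sup>2) = (\<Sum>i<N. \<Sum>j<N. expectation (\<lambda>\<omega>. U i \<omega> * U j \<omega>))"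
  proof -
    have "expectation (\<lambda>\<omega>. (V \<omega>)\<^sup>2) = (\<Sum>i<N. expectation (\<lambda>\<omega>. \<Sum>j<N. U i \<omega> * U j \<omega>))"
      unfolding V2 using intUU by (intro Bochner_Integration.integral_sum Bochner_Integration.integrable_sum) auto
    also have "\<dots> = (\<Sum>i<N. \<Sum>j<N. expectation (\<lambda>\<omega>. U i \<omega> * U j \<omega>))"
      using intUU by (intro sum.cong refl Bochner_Integration.integral_sum) auto
    finally show ?thesis .
  qed
  \<comment> \<open>Upper bounds on covariances suffice here. The diagonal adds
    \<open>4 * N\<close>, which becomes \<open>4 / N\<close> after dividing by
    \<open>N\<^sup>2\<close>.\<close>
  also have "\<dots> \<le> (\<Sum>i<N. \<Sum>j<N. ?\<theta> + (if i = j then 4 else 0))"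
    using diag cov \<theta> by (intro sum_mono) (auto intro: order_trans add_increasing)
  also have "\<dots> = (real N)\<^sup>2 * (4 / real N + ?\<theta>)"
    using N by (simp add: sum.distrib power2_eq_square algebra_simps)
  \<comment> \<open>The parameters put the bracket below \<open>m powr (- (2 * L))\<close>, which is
    below the truncation threshold.\<close>
  also have "\<dots> \<le> (real N)\<^sup>2 * (\<epsilon>\<^sup>2 * (\<epsilon>\<^sup>2 / 4) powr (1 / (p - 1)))"
    using xN gap_ge_powr[OF eps p m_ge, folded L_def] by (intro mult_left_mono) auto
  finally have EV: "expectation (\<lambda>\<omega>. (V \<omega>)\<^sup>2) \<le> (real N)\<^sup>2 * (\<epsilon>\<^sup>2 * (\<epsilon>\<^sup>2 / 4) powr (1 / (p - 1)))" .
  have Vb: "\<bar>V \<omega>\<bar> \<le> 2 * real N" for \<omega>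
  proof -
    have "\<bar>V \<omega>\<bar> \<le> (\<Sum>i<N. 2)"
      unfolding V_def using U2 by (intro order_trans[OF sum_abs] sum_mono) auto
    then show ?thesis by simp
  qed
  have intFH: "integrable M (\<lambda>\<omega>. F \<omega> * H i (interval_array k i \<omega>))" if "i < N" for i
    by (rule Bochner_Integration.integrable_bound[OF Fint])
      (use FM HM H1 that in \<open>auto simp: abs_mult mult_right_le_one_le\<close>)
  have FU: "F \<omega> * V \<omega> = (\<Sum>i<N. F \<omega> * H i (interval_array k i \<omega>) - iid_mean k (H i) * F \<omega>)" for \<omega>
    by (simp add: V_def U_def sum_distrib_left algebra_simps)
  have intFV: "integrable M (\<lambda>\<omega>. F \<omega> * V \<omega>)"
    unfolding FU using intFH Fint by (intro Bochner_Integration.integrable_sum Bochner_Integration.integrable_diff) auto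
  have "real N * \<epsilon>\<^sup>2 = (\<Sum>i<N. \<epsilon>\<^sup>2)" by simp
  also have "\<dots> < (\<Sum>i<N. expectation (\<lambda>\<omega>. F \<omega> * H i (interval_array k i \<omega>)))"
    using N HE by (intro sum_strict_mono) auto
  also have "\<dots> = expectation (\<lambda>\<omega>. F \<omega> * V \<omega>)"
  proof -
    have "expectation F = 0" using mean0 by (simp add: F_def[abs_def])
    then show ?thesis unfolding FU using intFH Fint by (simp add: Bochner_Integration.integral_sum)
  qed
  also have "\<dots> \<le> real N * \<epsilon>\<^sup>2"
    by (rule expectation_mult_le_truncated[OF p eps(1) _ intFV intFp intV2 Fp Vb EV]) (use N in simp)
  finally show False by simp
qed

end
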